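(* Let $N\ge 1$ be an integer and $p=1+2/N$. There exists a function $\gamma:(0,1)\to(0,\infty)$ (depending only on $N$) with $\limsup_{\alpha\to 1}\gamma(\alpha)<\infty$ such that the following holds. Let $\alpha\in(0,1)$, $T\in(0,\infty)$, let $u_0\ge 0$ be a measurable function on $\mathbb{R}^N$, and suppose that the problem $$\partial_t^{\alpha}u-\Delta u=u^p\ \text{ in }(0,T)\times\mathbb{R}^N,\qquad u(0)=u_0\ \text{ on }\mathbb{R}^N$$ has a nonnegative solution in $(0,T)$ (in the mild sense defined in the context). Then for all $z\in\mathbb{R}^N$ and all $\rho>0$ with $\rho^{2/\alpha}<T$, $$\int_{B(z;\rho)}u_0(y)\,dy\le \gamma(\alpha)\left(\frac{T}{\rho^{2/\alpha}}\right)^{(1-\alpha)N/2}\left[\log\left(\frac{T}{\rho^{2/\alpha}}\right)\right]^{-N/2}.$$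
   Context: $B(z;\rho)\subset\mathbb{R}^N$ is the closed ball of radius $\rho$ centered at $z$. $\partial_t^\alpha$ is the Caputo derivative of order $\alpha\in(0,1)$, $(\partial_t^{\alpha}f)(t)=\frac{1}{\Gamma(1-\alpha)}\frac{d}{dt}\int_0^t(t-\tau)^{-\alpha}(f(\tau)-f(0))\,d\tau$; it enters only through the following notion of solution. Let $G(t,x)=(4\pi t)^{-N/2}\exp(-|x|^2/(4t))$ for $t>0$, $x\in\mathbb{R}^N$, and $e^{t\Delta}v=G(t,\cdot)*v$. For $\theta>0$ let $$\psi_\alpha(\theta)=\frac1\pi\sum_{k=1}^\infty(-1)^{k-1}\theta^{-k\alpha-1}\frac{\Gamma(k\alpha+1)}{k!}\sin(k\pi\alpha),\qquad h_\alpha(\theta)=\frac1\alpha\theta^{-1-1/\alpha}\psi_\alpha(\theta^{-1/\alpha}).$$ The function $h_\alpha$ is a probability density on $(0,\infty)$. For $t>0$ define $$P_\alpha(t)=\int_0^\infty h_\alpha(\theta)e^{t^\alpha\theta\Delta}\,d\theta,\qquad S_\alpha(t)=\int_0^\infty\theta h_\alpha(\theta)e^{t^\alpha\theta\Delta}\,d\theta .$$ Definition of solution. Let $u_0$ be a nonnegative measurable function on $\mathbb{R}^N$ and $T\in(0,\infty]$. A nonnegative measurable function $u$ on $(0,T)\times\mathbb{R}^N$ is a solution in $(0,T)$ of $\partial_t^\alpha u-\Delta u=u^p$, $u(0)=u_0$, if $u(t,\cdot)$ is integrable on $\mathbb{R}^N$ for each $t\in(0,T)$ and $$u(t,x)=[P_\alpha(t)u_0](x)+\alpha\int_0^t(t-\tau)^{\alpha-1}[S_\alpha(t-\tau)u^p(\tau,\cdot)](x)\,d\tau$$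 for every $t\in(0,T)$ and almost every $x\in\mathbb{R}^N$. *)

theory Defs
  imports "HOL-Analysis.Analysis"
begin

definition heat_kernel :: "real \<Rightarrow> real ^ 'n \<Rightarrow> real" where
  "heat_kernel t x =
     (4 * pi * t) powr (- real CARD('n) / 2) * exp (- (norm x)\<^sup>2 / (4 * t))"

text \<open>
  The operators below are only applied to nonnegative functions. They take values in \<open>[0, \<infinity>]\<close>,
  so that no integrability assumption is hidden in their definitions.
\<close>

definition heat_semigroup :: "real \<Rightarrow> (real ^ 'n \<Rightarrow> real) \<Rightarrow> real ^ 'n \<Rightarrow> ennreal" where
  "heat_semigroup t v x = (\<integral>\<^sup>+ y. ennreal (heat_kernel t (x - y) * v y) \<partial>lebesgue)"

text \<open>The series over \<open>k \<ge> 1\<close> is indexed by \<open>k = Suc j\<close>, so \<open>(- 1) ^ j\<close> is the sign \<open>(-1)\<^sup>k\<^sup>-\<^sup>1\<close>.\<close>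

definition stable_density :: "real \<Rightarrow> real \<Rightarrow> real" where
  "stable_density \<alpha> \<theta> =
     1 / pi * (\<Sum>j. (- 1) ^ j * \<theta> powr (- real (Suc j) * \<alpha> - 1)
       * (Gamma (real (Suc j) * \<alpha> + 1) / fact (Suc j)) * sin (real (Suc j) * pi * \<alpha>))"

definition subordination_density :: "real \<Rightarrow> real \<Rightarrow> real" where
  "subordination_density \<alpha> \<theta> =
     1 / \<alpha> * \<theta> powr (- 1 - 1 / \<alpha>) * stable_density \<alpha> (\<theta> powr (- 1 / \<alpha>))"

definition P_op :: "real \<Rightarrow> real \<Rightarrow> (real ^ 'n \<Rightarrow> real) \<Rightarrow> real ^ 'n \<Rightarrow> ennreal" where
  "P_op \<alpha> t v x =
     (\<integral>\<^sup>+ \<theta>\<in>{0<..}. ennreal (subordination_density \<alpha> \<theta>)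
        * heat_semigroup (t powr \<alpha> * \<theta>) v x \<partial>lebesgue)"

definition S_op :: "real \<Rightarrow> real \<Rightarrow> (real ^ 'n \<Rightarrow> real) \<Rightarrow> real ^ 'n \<Rightarrow> ennreal" where
  "S_op \<alpha> t v x =
     (\<integral>\<^sup>+ \<theta>\<in>{0<..}. ennreal (\<theta> * subordination_density \<alpha> \<theta>)
        * heat_semigroup (t powr \<alpha> * \<theta>) v x \<partial>lebesgue)"

text \<open>
  Mild solutions \<open>u\<close> in \<open>(0, T)\<close>, \<open>0 < T \<le> \<infinity>\<close>, of the time-fractional problem
  \<open>\<partial>\<^sub>t\<^sup>\<alpha> u - \<Delta> u = u\<^sup>p\<close>, \<open>u(0) = u0\<close>. The values of \<open>u\<close> outside \<open>(0, T)\<close> are irrelevant.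
\<close>

definition mild_solution ::
  "real \<Rightarrow> real \<Rightarrow> (real ^ 'n \<Rightarrow> real) \<Rightarrow> ereal \<Rightarrow> (real \<Rightarrow> real ^ 'n \<Rightarrow> real) \<Rightarrow> bool" where
  "mild_solution \<alpha> p u0 T u \<longleftrightarrow>
     (\<lambda>(t, x). u t x) \<in> borel_measurable (lebesgue_on ({t. 0 < t \<and> ereal t < T} \<times> UNIV)) \<and>
     (\<forall>t. 0 < t \<and> ereal t < T \<longrightarrow>
        (\<forall>x. 0 \<le> u t x) \<and>
        integrable lebesgue (u t) \<and>
        (AE x in lebesgue.
           ennreal (u t x) =
             P_op \<alpha> t u0 x +
             ennreal \<alpha> * (\<integral>\<^sup>+ \<tau>\<in>{0<..<t}. ennreal ((t - \<tau>) powr (\<alpha> - 1))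
               * S_op \<alpha> (t - \<tau>) (\<lambda>y. u \<tau> y powr p) x \<partial>lebesgue)))"

end

theory Submission
  imports Defs "HOL-Complex_Analysis.Complex_Analysis" "HOL-Real_Asymp.Real_Asymp"
begin

text \<open>
  Put \<open>r = \<rho> powr (2 / \<alpha>)\<close> and \<open>p = 1 + 2 / N\<close>, let \<open>M\<close> be the mass of \<open>u0\<close> in the ball of radius
  \<open>\<rho>\<close> about \<open>z\<close>, and \<open>m t\<close> the mass of \<open>u t\<close> in the parabolic ball of radius \<open>t powr (\<alpha> / 2)\<close>
  about \<open>z\<close>. A Gaussian whose time is at most twice the squared radius of a ball keeps, of any mass
  that starts in the ball, a fraction that depends only on the dimension
  (\<open>heat_kernel_ball_ge\<close>). Hence the part \<open>\<theta> \<le> 2\<close> of the operators \<open>P\<close> and \<open>S\<close> keeps in the parabolic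
  ball at time \<open>t\<close> a fixed fraction of the initial mass and of the mass that \<open>u powr p\<close> created in
  the smaller parabolic balls at the times \<open>\<tau> < t\<close>, including those close to \<open>t\<close>. By Jensen's
  inequality on the balls of volume \<open>\<omega> \<tau> powr (\<alpha> N / 2)\<close>,
  \<open>m t \<ge> \<kappa> M + K T powr (\<alpha> - 1) \<integral> m \<tau> powr p \<tau> powr (- \<alpha>) d\<tau>\<close> for \<open>r < t < T\<close>, the integral being
  taken over \<open>r < \<tau> < t\<close> (\<open>mild_solution_mass_ge\<close>).
  The exponent is critical: the weight is exactly \<open>\<tau> powr (- \<alpha>)\<close>, which is at least
  \<open>r powr (1 - \<alpha>) / \<tau>\<close> and so has a logarithmic integral. A finite \<open>m\<close> can satisfy such an inequality
  only if \<open>K (r / T) powr (1 - \<alpha>) ln (T / r)\<close> is at most a multiple of \<open>(\<kappa> M) powr (- 2 / N)\<close>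
  (\<open>log_blow_up\<close>), and solving for \<open>M\<close> gives the estimate (\<open>mild_solution_mass_le\<close>).

  The density \<open>h\<close> of order \<open>\<alpha>\<close> enters \<open>\<kappa>\<close> and \<open>K\<close> only through a lower bound for the integral of the
  positive part of \<open>\<theta> h \<theta>\<close> over \<open>{0<..2}\<close>. For each \<open>\<alpha>\<close> this integral is positive, because \<open>h\<close> is a
  power series with \<open>h 0 > 0\<close> (\<open>subordination_density_moment_pos\<close>). A bound that survives
  \<open>\<alpha> \<rightarrow> 1\<close>, where \<open>h\<close> concentrates at \<open>1\<close> and its series cancels almost completely, comes from a
  contour integral. Tested against the hat function \<open>max 0 (1 - \<bar>\<theta> - 1\<bar>)\<close>, which lies below \<open>\<theta>\<close>, the
  series becomes an integral of a holomorphic function along the imaginary axis. Rotated to the real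
  axis (\<open>wright_contour_rotation\<close>), its integrand has an integrable bound that does not depend on
  \<open>\<alpha>\<close>, and its imaginary part tends to \<open>4 (sin (r / 2))\<^sup>2 / r\<^sup>2\<close>, the Fourier transform of the hat
  function, which is nonnegative (\<open>subordination_density_moment_uniform\<close>).
\<close>

section \<open>Heat that stays in a ball\<close>

text \<open>
  Every point of a ball has, at each smaller scale \<open>\<sigma>\<close>, a ball of comparable
  size within distance \<open>\<sigma>\<close> that lies inside the big ball, even when the point is
  on the boundary: move from the point towards the centre by \<open>\<sigma> / 2\<close>, or take
  the centre itself if it is nearer than that.
\<close>

lemma ex_cball_near_point:
  fixes y z :: "'a::euclidean_space"
  assumes "0 \<le> \<sigma>" "\<sigma> \<le> R" "dist z y \<le> R"
  obtains w where "cball w (\<sigma> / 2) \<subseteq> cball z R" "cball w (\<sigma> / 2) \<subseteq> cball y \<sigma>"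
proof (cases "dist z y < \<sigma> / 2")
  case True
  show ?thesis
  proof (rule that)
    show "cball z (\<sigma> / 2) \<subseteq> cball z R"
      using assms by auto
    show "cball z (\<sigma> / 2) \<subseteq> cball y \<sigma>"
    proof
      fix x assume "x \<in> cball z (\<sigma> / 2)"
      then show "x \<in> cball y \<sigma>"
        using True dist_triangle[of y x z] by (auto simp: dist_commute)
    qed
  qed
next
  case False
  define w where "w = y + (\<sigma> / 2 / dist z y) *\<^sub>R (z - y)"
  have wy: "dist w y \<le> \<sigma> / 2"
    using assms(1) by (auto simp: w_def dist_norm norm_minus_commute)
  have wz: "dist w z \<le> R - \<sigma> / 2"
  proof (cases "dist z y = 0")
    case True
    then show ?thesis using assms False by (auto simp: w_def)
  next
    case nz: False
    have "z - w = (1 - \<sigma> / 2 / dist z y) *\<^sub>R (z - y)"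
      by (simp add: w_def algebra_simps)
    then have "dist z w = \<bar>1 - \<sigma> / 2 / dist z y\<bar> * dist z y"
      by (simp add: dist_norm)
    also have "\<dots> = dist z y - \<sigma> / 2"
      using False nz assms(1) zero_le_dist[of z y] by (simp add: abs_if field_simps)
    finally show ?thesis using assms(3) by (simp add: dist_commute)
  qed
  show ?thesis
  proof (rule that)
    show "cball w (\<sigma> / 2) \<subseteq> cball z R"
    proof
      fix x assume "x \<in> cball w (\<sigma> / 2)"
      then show "x \<in> cball z R"
        using wz dist_triangle[of z x w] by (auto simp: dist_commute)
    qed
    show "cball w (\<sigma> / 2) \<subseteq> cball y \<sigma>"
    proof
      fix x assume "x \<in> cball w (\<sigma> / 2)"
      then show "x \<in> cball y \<sigma>"
        using wy dist_triangle[of y x w] by (auto simp: dist_commute)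
    qed
  qed
qed

lemma heat_kernel_nonneg: "0 \<le> heat_kernel t x"
  by (simp add: heat_kernel_def)

lemma borel_measurable_heat_kernel [measurable (raw)]:
  assumes [measurable]: "f \<in> borel_measurable M" "g \<in> borel_measurable M"
  shows "(\<lambda>x. heat_kernel (f x) (g x)) \<in> borel_measurable M"
  unfolding heat_kernel_def by measurable

text \<open>
  The volume of a ball of radius \<open>sqrt (s / 8)\<close> times the lower bound \<open>(4 \<pi>
  s) powr (- N / 2) exp (- 1 / 8)\<close> of the heat kernel at time \<open>s\<close> on the
  distances up to \<open>sqrt (s / 2)\<close>; the powers of \<open>s\<close> cancel.
\<close>

definition heat_ball_const :: "'n::finite itself \<Rightarrow> real" where
  "heat_ball_const _ = unit_ball_vol (real CARD('n)) * (32 * pi) powr (- real CARD('n) / 2) * exp (- 1 / 8)"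

lemma heat_ball_const_pos: "0 < heat_ball_const TYPE('n::finite)"
  by (simp add: heat_ball_const_def unit_ball_vol_pos)

text \<open>
  At time \<open>s\<close> the kernel is of full size \<open>s powr (- N / 2)\<close> at distance up
  to \<open>sqrt (s / 2)\<close> from its centre, and a ball of that order of size around the centre
  meets the given one in a fixed proportion. The bound stays uniform down to \<open>s = 0\<close>,
  which is what allows the whole interval \<open>\<tau> < t\<close> in Duhamel's formula.
\<close>

lemma heat_kernel_ball_ge:
  fixes y z :: "real ^ 'n"
  assumes "0 < s" "s \<le> 2 * R\<^sup>2" "0 \<le> R" "y \<in> cball z R"
  shows "ennreal (heat_ball_const TYPE('n)) \<le>
    (\<integral>\<^sup>+ x\<in>cball z R. ennreal (heat_kernel s (x - y)) \<partial>lborel)"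
proof -
  define \<sigma> where "\<sigma> = sqrt (s / 2)"
  have \<sigma>: "0 < \<sigma>" "\<sigma>\<^sup>2 = s / 2" using assms(1) by (simp_all add: \<sigma>_def)
  have "\<sigma> \<le> R"
    unfolding \<sigma>_def using assms(2,3) by (intro real_le_lsqrt) auto
  then obtain w where w: "cball w (\<sigma> / 2) \<subseteq> cball z R" "cball w (\<sigma> / 2) \<subseteq> cball y \<sigma>"
    using ex_cball_near_point[of \<sigma> R z y] \<sigma> assms(4) by auto
  let ?N = "real CARD('n)"
  define k where "k = (4 * pi * s) powr (- ?N / 2) * exp (- 1 / 8)"
  have "\<sigma> / 2 = (s / 8) powr (1 / 2)"
    using assms(1) by (simp add: \<sigma>_def powr_half_sqrt real_sqrt_divide)
       (simp add: real_sqrt_mult[of 4 2, simplified])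
  then have "(\<sigma> / 2) ^ CARD('n) = (s / 8) powr (?N / 2)"
    using assms(1) by (simp add: powr_realpow[symmetric] powr_powr del: powr_half_sqrt)
  then have "heat_ball_const TYPE('n) = k * (unit_ball_vol ?N * (\<sigma> / 2) ^ CARD('n))"
  proof -
    assume h: "(\<sigma> / 2) ^ CARD('n) = (s / 8) powr (?N / 2)"
    have "(32 * pi) powr (- ?N / 2) = (4 * pi * s * (8 / s)) powr (- ?N / 2)" using assms(1) by simp
    also have "\<dots> = (4 * pi * s) powr (- ?N / 2) * (8 / s) powr (- ?N / 2)"
      using assms(1) by (subst powr_mult) auto
    also have "(8 / s) powr (- ?N / 2) = (s / 8) powr (?N / 2)"
      using assms(1) by (simp add: powr_minus powr_divide)
    finally show ?thesis unfolding heat_ball_const_def k_def h by simp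
  qed
  then have "ennreal (heat_ball_const TYPE('n)) = ennreal k * emeasure lborel (cball w (\<sigma> / 2))"
    using \<sigma>(1) by (subst emeasure_cball) (auto simp: k_def ennreal_mult[symmetric])
  also have "\<dots> = (\<integral>\<^sup>+ x. ennreal k * indicator (cball w (\<sigma> / 2)) x \<partial>lborel)"
    by (simp add: nn_integral_cmult_indicator)
  also have "\<dots> \<le> (\<integral>\<^sup>+ x\<in>cball z R. ennreal (heat_kernel s (x - y)) \<partial>lborel)"
  proof (rule nn_integral_mono)
    fix x
    have "k \<le> heat_kernel s (x - y)" if "x \<in> cball w (\<sigma> / 2)"
    proof -
      have "norm (x - y) \<le> \<sigma>" using that w(2) by (auto simp: dist_norm norm_minus_commute)
      then have "(norm (x - y))\<^sup>2 \<le> \<sigma>\<^sup>2" by (intro power_mono) auto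
      then have "- 1 / 8 \<le> - (norm (x - y))\<^sup>2 / (4 * s)"
        using \<sigma>(2) assms(1) by (simp add: field_simps)
      then show ?thesis unfolding k_def heat_kernel_def by (intro mult_left_mono) auto
    qed
    then show "ennreal k * indicator (cball w (\<sigma> / 2)) x
        \<le> ennreal (heat_kernel s (x - y)) * indicator (cball z R) x"
      using w(1) by (auto split: split_indicator intro: ennreal_leI)
  qed
  finally show ?thesis .
qed

section \<open>Jensen and blow-up inequalities\<close>

lemma powr_tangent_le:
  fixes p x a :: real
  assumes "1 \<le> p" "0 \<le> x" "0 \<le> a"
  shows "p * a powr (p - 1) * x \<le> x powr p + (p - 1) * a powr p"
proof (cases "p = 1 \<or> a = 0 \<or> x = 0")
  case True then show ?thesis using assms by (auto simp: powr_def)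
next
  case False
  then have "1 < p" "0 < a" "0 < x" using assms by auto
  have "(x powr p) powr (1 / p) * (a powr p) powr (1 - 1 / p) \<le> 1 / p * x powr p + (1 - 1 / p) * a powr p"
    using \<open>1 < p\<close> \<open>0 < x\<close> \<open>0 < a\<close> by (intro Youngs_inequality_0) (auto simp: field_simps)
  moreover have "p * (1 - 1 / p) = p - 1" using \<open>1 < p\<close> by (simp add: field_simps)
  ultimately have "x * a powr (p - 1) \<le> 1 / p * x powr p + (1 - 1 / p) * a powr p"
    using \<open>1 < p\<close> \<open>0 < x\<close> by (simp add: powr_powr)
  then have "p * (x * a powr (p - 1)) \<le> p * (1 / p * x powr p + (1 - 1 / p) * a powr p)"
    using \<open>1 < p\<close> by (intro mult_left_mono) auto
  also have "\<dots> = x powr p + (p - 1) * a powr p"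
    using \<open>1 < p\<close> by (simp add: field_simps)
  finally show ?thesis by (simp add: ac_simps)
qed

text \<open>
  Jensen's inequality, as the integral over \<open>B\<close> of the tangent inequality at the mean
  value of \<open>f\<close>.
\<close>

lemma nn_integral_powr_ge:
  fixes f :: "'a \<Rightarrow> real"
  assumes [measurable]: "B \<in> sets M" "f \<in> borel_measurable M"
    and f: "\<And>x. 0 \<le> f x" and p: "1 \<le> p" and V: "0 < V" "emeasure M B = ennreal V"
    and m: "0 \<le> m" "(\<integral>\<^sup>+ x\<in>B. ennreal (f x) \<partial>M) = ennreal m"
  shows "ennreal (m powr p * V powr (1 - p)) \<le> (\<integral>\<^sup>+ x\<in>B. ennreal (f x powr p) \<partial>M)"
proof -
  define a where "a = m / V"
  have a: "0 \<le> a" "m = a * V" using m V by (auto simp: a_def)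
  have e1: "m powr p * V powr (1 - p) = a powr p * V"
    using a V by (simp add: powr_mult powr_add[symmetric])
  have e2: "a powr (p - 1) * m = a powr p * V"
    using a by (cases "a = 0") (auto simp: powr_diff)
  have e3: "p * (a powr p * V) = a powr p * V + (p - 1) * (a powr p * V)" by (simp add: algebra_simps)
  have "ennreal (p * a powr (p - 1)) * ennreal m = (\<integral>\<^sup>+ x\<in>B. ennreal (p * a powr (p - 1) * f x) \<partial>M)"
    unfolding m(2)[symmetric] using p f
    by (subst nn_integral_cmult[symmetric]) (auto intro!: nn_integral_cong simp: ennreal_mult mult.assoc)
  also have "\<dots> \<le> (\<integral>\<^sup>+ x\<in>B. (ennreal (f x powr p) + ennreal ((p - 1) * a powr p)) \<partial>M)"
    using powr_tangent_le[OF p f a(1)] p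
    by (intro nn_integral_mono mult_right_mono) (auto simp: ennreal_plus[symmetric] simp del: ennreal_plus intro!: ennreal_leI)
  also have "\<dots> = (\<integral>\<^sup>+ x. ennreal (f x powr p) * indicator B x + ennreal ((p - 1) * a powr p) * indicator B x \<partial>M)"
    by (auto intro!: nn_integral_cong simp: distrib_right)
  also have "\<dots> = (\<integral>\<^sup>+ x\<in>B. ennreal (f x powr p) \<partial>M) + ennreal ((p - 1) * a powr p) * ennreal V"
    by (subst nn_integral_add) (auto simp: nn_integral_cmult_indicator V)
  finally have **: "ennreal (p * a powr (p - 1)) * ennreal m \<le> (\<integral>\<^sup>+ x\<in>B. ennreal (f x powr p) \<partial>M) + ennreal ((p - 1) * a powr p) * ennreal V" .
  have "p * a powr (p - 1) * m = a powr p * V + (p - 1) * (a powr p * V)"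
    using e2 e3 by (simp add: mult.assoc)
  then have e4: "ennreal (p * a powr (p - 1)) * ennreal m = ennreal (a powr p * V) + ennreal ((p - 1) * (a powr p * V))"
    using p a(1) V m(1) by (simp add: ennreal_mult[symmetric] ennreal_plus[symmetric] del: ennreal_plus)
  have *: "ennreal (a powr p * V) + ennreal ((p - 1) * (a powr p * V))
      \<le> (\<integral>\<^sup>+ x\<in>B. ennreal (f x powr p) \<partial>M) + ennreal ((p - 1) * (a powr p * V))"
    using ** p a(1) V unfolding e4 by (simp add: ennreal_mult[symmetric] mult.assoc)
  show ?thesis unfolding e1
    using * by (simp add: ennreal_add_left_cancel_le add.commute[of _ "ennreal ((p - 1) * (a powr p * V))"])
qed

lemma nn_integral_inverse_Ioo:
  fixes a b :: real
  assumes "0 < a" "a \<le> b"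
  shows "(\<integral>\<^sup>+ x\<in>{a<..<b}. ennreal (1 / x) \<partial>lborel) = ennreal (ln (b / a))"
proof -
  have "(\<integral>\<^sup>+ x\<in>{a<..<b}. ennreal (1 / x) \<partial>lborel) = (\<integral>\<^sup>+ x\<in>{a..b}. ennreal (1 / x) \<partial>lborel)"
  proof (rule nn_integral_cong_AE)
    show "AE x in lborel. ennreal (1 / x) * indicator {a<..<b} x = ennreal (1 / x) * indicator {a..b} x"
      using AE_lborel_singleton[of a] AE_lborel_singleton[of b]
      by eventually_elim (auto split: split_indicator)
  qed
  also have "\<dots> = ennreal (ln b - ln a)"
    using assms by (intro nn_integral_FTC_Icc) (auto intro!: derivative_eq_intros)
  finally show ?thesis using assms by (simp add: ln_div)
qed

text \<open>
  The ODE \<open>m' = B m powr (1 + q) / t\<close> blows up in finite logarithmic time; this is the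
  version for an integral inequality. The right-hand side \<open>F\<close> of the inequality is
  monotone, and once it has the value \<open>2 ^ j * A\<close> it doubles after the time \<open>ln
  s\<close> has grown by \<open>(2 ^ j * A) powr (- q) / B\<close>. These times form a geometric
  series, whose sum is the bound. The integrand is a separate function \<open>\<Phi>\<close> because
  the mass of a Lebesgue measurable solution is Borel measurable in time only up to a null set.
\<close>

lemma log_blow_up:
  fixes m :: "real \<Rightarrow> real" and \<Phi> :: "real \<Rightarrow> ennreal" and A B q r T :: real
  assumes A: "0 < A" and B: "0 < B" and q: "0 < q" and r: "0 < r"
    and \<Phi> [measurable]: "\<Phi> \<in> borel_measurable borel"
    and low: "AE \<tau> in lborel. r < \<tau> \<longrightarrow> \<tau> < T \<longrightarrow> ennreal (B * m \<tau> powr (1 + q) / \<tau>) \<le> \<Phi> \<tau>"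
    and m: "\<And>t. r < t \<Longrightarrow> t < T \<Longrightarrow>
      ennreal A + (\<integral>\<^sup>+ \<tau>\<in>{r<..<t}. \<Phi> \<tau> \<partial>lborel) \<le> ennreal (m t)"
    and t: "r < t" "t < T"
  shows "B * ln (t / r) \<le> A powr (- q) / (1 - 2 powr (- q))"
proof (rule ccontr)
  assume neg: "\<not> ?thesis"
  define F where "F t = ennreal A + (\<integral>\<^sup>+ \<tau>\<in>{r<..<t}. \<Phi> \<tau> \<partial>lborel)" for t
  define L :: real where "L = 2 powr (- q)"
  have L: "0 < L" "L < 1" using q by (auto simp: L_def powr_less_one)
  have "ennreal (2 ^ j * A) \<le> F s"
    if "r \<le> s" "s < T" "A powr (- q) * (\<Sum>i<j. L ^ i) \<le> B * ln (s / r)" for j s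
    using that
  proof (induction j arbitrary: s)
    case 0 then show ?case by (simp add: F_def)
  next
    case (Suc j)
    \<comment> \<open>Going back by the doubling time \<open>d\<close> of step \<open>j\<close> leads to a time where the induction hypothesis applies.\<close>
    define d where "d = A powr (- q) * L ^ j / B"
    define s' where "s' = s * exp (- d)"
    have d: "0 < d" using A B L by (simp add: d_def)
    have s: "0 < s" using Suc.prems r by simp
    have s': "0 < s'" "s' \<le> s" using s d by (auto simp: s'_def)
    have ln: "ln (s / r) = ln (s' / r) + d" using s r by (simp add: s'_def ln_div ln_mult)
    have Bd: "B * d = A powr (- q) * L ^ j" using B by (simp add: d_def)
    have lin: "A powr (- q) * (\<Sum>i<j. L ^ i) \<le> B * ln (s' / r)"
      using Suc.prems(3) Bd by (simp add: ln algebra_simps)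
    have "0 \<le> A powr (- q) * (\<Sum>i<j. L ^ i)" using A L by (intro mult_nonneg_nonneg sum_nonneg) auto
    then have "0 \<le> ln (s' / r)" using lin B by (smt (verit) mult_pos_neg)
    then have rs': "r \<le> s'" using r s' by (simp add: ln_div)
    have Fs': "ennreal (2 ^ j * A) \<le> F s'" using Suc.IH[OF rs' _ lin] s' Suc.prems by simp
    let ?c = "B * (2 ^ j * A) powr (1 + q)"
    have mlow: "2 ^ j * A \<le> m \<tau>" if "\<tau> \<in> {s'<..<s}" for \<tau>
    proof -
      have "F s' \<le> F \<tau>" unfolding F_def using that
        by (intro add_left_mono nn_integral_mono) (auto split: split_indicator)
      also have "F \<tau> \<le> ennreal (m \<tau>)" using m[of \<tau>] that rs' Suc.prems by (simp add: F_def)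
      finally have "ennreal (2 ^ j * A) \<le> ennreal (m \<tau>)" using Fs' by (rule order_trans[rotated])
      moreover have "0 < 2 ^ j * A" using A by simp
      ultimately show ?thesis by (smt (verit) ennreal_le_iff2)
    qed
    have "2 powr (q * real j) * 2 powr (- q * real j) = (1 :: real)"
      by (subst powr_add[symmetric]) simp
    moreover have "L ^ j = 2 powr (- q * real j)"
      by (simp add: L_def powr_powr powr_realpow[symmetric])
    moreover have "(2 ^ j :: real) powr q = 2 powr (q * real j)"
      by (simp add: powr_powr powr_realpow[symmetric] mult.commute)
    ultimately have two: "(2 ^ j) powr q * L ^ j = 1" by simp
    have Aq: "A powr q * A powr (- q) = 1" using A by (subst powr_add[symmetric]) simp
    have pw: "(2 ^ j * A) powr (1 + q) = 2 ^ j * A * ((2 ^ j) powr q * A powr q)"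
      using A by (simp add: powr_add powr_mult)
    have "?c * d = (2 ^ j * A) powr (1 + q) * (B * d)" by (simp only: ac_simps)
    also have "\<dots> = 2 ^ j * A * (((2 ^ j) powr q * L ^ j) * (A powr q * A powr (- q)))"
      unfolding Bd pw by (simp only: ac_simps)
    finally have cd: "?c * d = 2 ^ j * A" by (simp only: two Aq mult_1_right)
    have "ennreal (2 ^ j * A) = ennreal ?c * ennreal (ln (s / s'))"
    proof -
      have "ln (s / s') = d" using s by (simp add: s'_def ln_div ln_mult)
      then show ?thesis using cd B d by (simp add: ennreal_mult[symmetric])
    qed
    also have "\<dots> = (\<integral>\<^sup>+ \<tau>\<in>{s'<..<s}. ennreal (?c * (1 / \<tau>)) \<partial>lborel)"
    proof -
      have "ennreal (?c * (1 / \<tau>)) = ennreal ?c * ennreal (1 / \<tau>)" for \<tau>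
        using B by (intro ennreal_mult') simp
      then show ?thesis
        using s' nn_integral_inverse_Ioo[of s' s] by (simp only: mult.assoc) (subst nn_integral_cmult, auto)
    qed
    also have "\<dots> \<le> (\<integral>\<^sup>+ \<tau>\<in>{s'<..<s}. \<Phi> \<tau> \<partial>lborel)"
    proof (rule nn_integral_mono_AE)
      have le: "?c * (1 / \<tau>) \<le> B * m \<tau> powr (1 + q) / \<tau>" if "\<tau> \<in> {s'<..<s}" for \<tau>
        using that mlow[OF that] A B q s' by (auto intro!: divide_right_mono mult_left_mono powr_mono2)
      show "AE \<tau> in lborel. ennreal (?c * (1 / \<tau>)) * indicator {s'<..<s} \<tau> \<le> \<Phi> \<tau> * indicator {s'<..<s} \<tau>"
      proof (rule eventually_mono[OF low])
        fix \<tau> assume "r < \<tau> \<longrightarrow> \<tau> < T \<longrightarrow> ennreal (B * m \<tau> powr (1 + q) / \<tau>) \<le> \<Phi> \<tau>"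
        then show "ennreal (?c * (1 / \<tau>)) * indicator {s'<..<s} \<tau> \<le> \<Phi> \<tau> * indicator {s'<..<s} \<tau>"
          using le[of \<tau>] rs' Suc.prems(2)
          by (auto split: split_indicator intro: order_trans[OF ennreal_leI])
      qed
    qed
    finally have inc: "ennreal (2 ^ j * A) \<le> (\<integral>\<^sup>+ \<tau>\<in>{s'<..<s}. \<Phi> \<tau> \<partial>lborel)" .
    have "ennreal (2 ^ Suc j * A) = ennreal (2 ^ j * A) + ennreal (2 ^ j * A)"
      using A by (simp add: ennreal_plus[symmetric] del: ennreal_plus)
    also have "\<dots> \<le> F s' + (\<integral>\<^sup>+ \<tau>\<in>{s'<..<s}. \<Phi> \<tau> \<partial>lborel)"
      by (intro add_mono Fs' inc)
    also have "\<dots> \<le> F s"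
      unfolding F_def add.assoc using rs' s'
      by (subst nn_integral_add[symmetric])
         (auto intro!: add_left_mono nn_integral_mono split: split_indicator)
    finally show ?case .
  qed
  have large: "ennreal (2 ^ j * A) \<le> ennreal (m t)" for j
  proof -
    have "(\<Sum>i<j. L ^ i) \<le> 1 / (1 - L)"
      using L by (simp add: sum_gp_strict divide_right_mono)
    then have "A powr (- q) * (\<Sum>i<j. L ^ i) \<le> A powr (- q) * (1 / (1 - L))"
      by (intro mult_left_mono) auto
    also have "\<dots> \<le> B * ln (t / r)" using neg by (simp add: L_def)
    finally have "ennreal (2 ^ j * A) \<le> F t"
      using \<open>\<And>s j. r \<le> s \<Longrightarrow> s < T \<Longrightarrow> _ \<Longrightarrow> ennreal (2 ^ j * A) \<le> F s\<close> t by simp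
    then show ?thesis using m[OF t] by (simp add: F_def)
  qed
  obtain j where "m t / A < 2 ^ j" using real_arch_pow[of 2 "m t / A"] by auto
  then have "m t < 2 ^ j * A" using A by (simp add: field_simps)
  moreover have "0 < 2 ^ j * A" using A by simp
  ultimately show False using large[of j] by (smt (verit) ennreal_le_iff2)
qed

section \<open>Subordinated heat operators\<close>

text \<open>
  The common form of \<open>P_op\<close> and \<open>S_op\<close>, with the weight and the function
  in \<open>[0, \<infinity>]\<close> and integrals over \<open>lborel\<close>, so that Tonelli's
  theorem applies to Borel data.
\<close>

definition heat_average ::
  "(real \<Rightarrow> ennreal) \<Rightarrow> real \<Rightarrow> (real ^ 'n \<Rightarrow> ennreal) \<Rightarrow> real ^ 'n \<Rightarrow> ennreal" where
  "heat_average g s v x = (\<integral>\<^sup>+ \<theta>\<in>{0<..}. g \<theta> *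
     (\<integral>\<^sup>+ y. ennreal (heat_kernel (s * \<theta>) (x - y)) * v y \<partial>lborel) \<partial>lborel)"

lemma borel_measurable_heat_average [measurable (raw)]:
  assumes [measurable]: "g \<in> borel_measurable borel" "s \<in> borel_measurable M"
    "(\<lambda>(a, y). v a y) \<in> borel_measurable (M \<Otimes>\<^sub>M lborel)" "f \<in> borel_measurable M"
  shows "(\<lambda>a. heat_average g (s a) (v a) (f a)) \<in> borel_measurable M"
  unfolding heat_average_def by measurable

lemma heat_semigroup_eq_nn_integral:
  assumes "\<And>y. 0 \<le> v y" "AE y in lborel. ennreal (v y) = V y"
  shows "heat_semigroup t v x = (\<integral>\<^sup>+ y. ennreal (heat_kernel t (x - y)) * V y \<partial>lborel)"
  unfolding heat_semigroup_def nn_integral_completion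
proof (rule nn_integral_cong_AE)
  show "AE y in lborel. ennreal (heat_kernel t (x - y) * v y) = ennreal (heat_kernel t (x - y)) * V y"
    using assms(2) by eventually_elim (metis ennreal_mult assms(1) heat_kernel_nonneg)
qed

lemma P_op_eq_heat_average:
  assumes "\<And>y. 0 \<le> v y" "AE y in lborel. ennreal (v y) = V y"
  shows "P_op \<alpha> t v x =
    heat_average (\<lambda>\<theta>. ennreal (subordination_density \<alpha> \<theta>)) (t powr \<alpha>) V x"
  unfolding P_op_def heat_average_def nn_integral_completion heat_semigroup_eq_nn_integral[OF assms] ..

lemma S_op_eq_heat_average:
  assumes "\<And>y. 0 \<le> v y" "AE y in lborel. ennreal (v y) = V y"
  shows "S_op \<alpha> t v x =
    heat_average (\<lambda>\<theta>. ennreal (\<theta> * subordination_density \<alpha> \<theta>)) (t powr \<alpha>) V x"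
  unfolding S_op_def heat_average_def nn_integral_completion heat_semigroup_eq_nn_integral[OF assms] ..

text \<open>
  For \<open>\<theta> \<le> 2\<close> the time \<open>s * \<theta>\<close> is at most \<open>2 *
  R\<^sup>2\<close>, so by Tonelli every such \<open>\<theta>\<close> contributes at least the
  fraction from \<open>heat_kernel_ball_ge\<close> of the mass in \<open>D\<close>.
\<close>

lemma heat_average_ball_ge:
  fixes v :: "real ^ 'n \<Rightarrow> ennreal"
  assumes [measurable]: "g \<in> borel_measurable borel" "v \<in> borel_measurable borel" "D \<in> sets borel"
    and s: "0 < s" "s \<le> R\<^sup>2" "0 \<le> R" and D: "D \<subseteq> cball z R"
  shows "ennreal (heat_ball_const TYPE('n)) * (\<integral>\<^sup>+ \<theta>\<in>{0<..2}. g \<theta> \<partial>lborel) * (\<integral>\<^sup>+ y\<in>D. v y \<partial>lborel)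
    \<le> (\<integral>\<^sup>+ x\<in>cball z R. heat_average g s v x \<partial>lborel)"
proof -
  let ?B = "cball z R" and ?k = "ennreal (heat_ball_const TYPE('n))"
  have [measurable]: "?B \<in> sets borel" by simp
  let ?K = "\<lambda>\<theta> x y. ennreal (heat_kernel (s * \<theta>) (x - y))"
  have inner: "?k * (\<integral>\<^sup>+ y\<in>D. v y \<partial>lborel) \<le> (\<integral>\<^sup>+ x\<in>?B. (\<integral>\<^sup>+ y. ?K \<theta> x y * v y \<partial>lborel) \<partial>lborel)"
    if \<theta>: "\<theta> \<in> {0<..2}" for \<theta>
  proof -
    have "?k * (\<integral>\<^sup>+ y\<in>D. v y \<partial>lborel) = (\<integral>\<^sup>+ y. ?k * (v y * indicator D y) \<partial>lborel)"
      by (simp add: nn_integral_cmult)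
    also have "\<dots> \<le> (\<integral>\<^sup>+ y. (\<integral>\<^sup>+ x\<in>?B. ?K \<theta> x y \<partial>lborel) * v y \<partial>lborel)"
    proof (rule nn_integral_mono)
      fix y
      have "?k \<le> (\<integral>\<^sup>+ x\<in>?B. ?K \<theta> x y \<partial>lborel)" if "y \<in> D"
      proof (rule heat_kernel_ball_ge)
        show "s * \<theta> \<le> 2 * R\<^sup>2"
          using mult_mono[of s "R\<^sup>2" \<theta> 2] s \<theta> by (simp add: mult.commute)
      qed (use s \<theta> D that in auto)
      then show "?k * (v y * indicator D y) \<le> (\<integral>\<^sup>+ x\<in>?B. ?K \<theta> x y \<partial>lborel) * v y"
        by (auto split: split_indicator intro: mult_right_mono)
    qed
    also have "\<dots> = (\<integral>\<^sup>+ y. (\<integral>\<^sup>+ x. ?K \<theta> x y * v y * indicator ?B x \<partial>lborel) \<partial>lborel)"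
    proof (rule nn_integral_cong)
      fix y
      show "(\<integral>\<^sup>+ x\<in>?B. ?K \<theta> x y \<partial>lborel) * v y = (\<integral>\<^sup>+ x. ?K \<theta> x y * v y * indicator ?B x \<partial>lborel)"
        by (subst nn_integral_multc[symmetric], measurable) (simp add: mult.assoc mult.commute[of _ "v y"])
    qed
    also have "\<dots> = (\<integral>\<^sup>+ x. (\<integral>\<^sup>+ y. ?K \<theta> x y * v y * indicator ?B x \<partial>lborel) \<partial>lborel)"
      by (rule lborel_pair.Fubini') measurable
    also have "\<dots> = (\<integral>\<^sup>+ x\<in>?B. (\<integral>\<^sup>+ y. ?K \<theta> x y * v y \<partial>lborel) \<partial>lborel)"
      by (intro nn_integral_cong nn_integral_multc) measurable
    finally show ?thesis .
  qed
  have "?k * (\<integral>\<^sup>+ \<theta>\<in>{0<..2}. g \<theta> \<partial>lborel) * (\<integral>\<^sup>+ y\<in>D. v y \<partial>lborel)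
      = (\<integral>\<^sup>+ \<theta>. (g \<theta> * indicator {0<..2} \<theta>) * (?k * (\<integral>\<^sup>+ y\<in>D. v y \<partial>lborel)) \<partial>lborel)"
    by (subst nn_integral_multc) (auto simp: ac_simps)
  also have "\<dots> \<le> (\<integral>\<^sup>+ \<theta>. (g \<theta> * indicator {0<..} \<theta>) *
      (\<integral>\<^sup>+ x\<in>?B. (\<integral>\<^sup>+ y. ?K \<theta> x y * v y \<partial>lborel) \<partial>lborel) \<partial>lborel)"
    using inner by (intro nn_integral_mono) (auto split: split_indicator intro!: mult_left_mono)
  also have "\<dots> = (\<integral>\<^sup>+ \<theta>. (\<integral>\<^sup>+ x. (g \<theta> * indicator {0<..} \<theta>) *
      ((\<integral>\<^sup>+ y. ?K \<theta> x y * v y \<partial>lborel) * indicator ?B x) \<partial>lborel) \<partial>lborel)"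
    by (intro nn_integral_cong, subst nn_integral_cmult) auto
  also have "\<dots> = (\<integral>\<^sup>+ x. (\<integral>\<^sup>+ \<theta>. (g \<theta> * indicator {0<..} \<theta>) *
      ((\<integral>\<^sup>+ y. ?K \<theta> x y * v y \<partial>lborel) * indicator ?B x) \<partial>lborel) \<partial>lborel)"
    by (rule lborel_pair.Fubini') measurable
  also have "\<dots> = (\<integral>\<^sup>+ x\<in>?B. heat_average g s v x \<partial>lborel)"
    unfolding heat_average_def
    by (intro nn_integral_cong, subst nn_integral_multc[symmetric]) (auto simp: ac_simps)
  finally show ?thesis .
qed

section \<open>Mass of a solution in parabolic balls\<close>

lemma borel_measurable_subordination_density [measurable]:
  "subordination_density \<alpha> \<in> borel_measurable borel"
  unfolding subordination_density_def stable_density_def by measurable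

lemma borel_representative:
  fixes f :: "'a::euclidean_space \<Rightarrow> ennreal"
  assumes "f \<in> borel_measurable lebesgue"
  obtains F where "F \<in> borel_measurable borel" "AE x in lborel. f x = F x"
  using completion_ex_borel_measurable[of f lborel] assms by auto

text \<open>
  A solution is only Lebesgue measurable jointly in time and space, and that does not suffice for
  Tonelli's theorem on the product. The power of the solution is replaced by a Borel function that
  agrees with it almost everywhere in space at almost every time, which leaves the Duhamel integral
  unchanged.
\<close>

lemma mild_solution_borel_powr:
  fixes u :: "real \<Rightarrow> real ^ 'n \<Rightarrow> real"
  assumes "mild_solution \<alpha> p u0 (ereal T) u"
  obtains V :: "real \<Rightarrow> real ^ 'n \<Rightarrow> ennreal"
  where "(\<lambda>(\<tau>, y). V \<tau> y) \<in> borel_measurable (borel \<Otimes>\<^sub>M borel)"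
    "AE \<tau> in lborel. \<tau> \<in> {0<..<T} \<longrightarrow> (AE y in lborel. ennreal (u \<tau> y powr p) = V \<tau> y)"
proof -
  let ?S = "{0<..<T} \<times> (UNIV :: (real ^ 'n) set)"
  have "{t. 0 < t \<and> ereal t < ereal T} = {0<..<T}" by auto
  then have u: "(\<lambda>(t, x). u t x) \<in> borel_measurable (lebesgue_on ?S)"
    using assms by (simp add: mild_solution_def)
  have S: "?S \<in> sets lebesgue"
  proof -
    have "?S \<in> sets borel" by (intro borel_open open_Times) auto
    then show ?thesis using sets_completionI_sets[of ?S lborel] by simp
  qed
  have "(\<lambda>z. if z \<in> ?S then (case z of (t, x) \<Rightarrow> u t x) else 0) \<in> borel_measurable lebesgue"
    using borel_measurable_if[OF S] u by blast
  then have "(\<lambda>z. ennreal ((if z \<in> ?S then (case z of (t, x) \<Rightarrow> u t x) else 0) powr p)) \<in> borel_measurable lebesgue"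
    by measurable
  then obtain F where F: "F \<in> borel_measurable borel"
    "AE z in lborel. ennreal ((if z \<in> ?S then (case z of (t, x) \<Rightarrow> u t x) else 0) powr p) = F z"
    by (rule borel_representative)
  show ?thesis
  proof (rule that)
    show "(\<lambda>(\<tau>, y). F (\<tau>, y)) \<in> borel_measurable (borel \<Otimes>\<^sub>M borel)"
      using F(1) by (simp add: borel_prod)
    have "AE z in lborel \<Otimes>\<^sub>M lborel.
        ennreal ((if z \<in> ?S then (case z of (t, x) \<Rightarrow> u t x) else 0) powr p) = F z"
      using F(2) by (simp only: lborel_prod)
    from lborel_pair.AE_pair[OF this]
    show "AE \<tau> in lborel. \<tau> \<in> {0<..<T} \<longrightarrow> (AE y in lborel. ennreal (u \<tau> y powr p) = F (\<tau>, y))"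
      by (rule eventually_mono) (auto elim!: eventually_mono)
  qed
qed

lemma borel_measurable_nn_integral_cball [measurable]:
  fixes V :: "real \<Rightarrow> 'a::euclidean_space \<Rightarrow> ennreal"
  assumes [measurable]: "(\<lambda>(\<tau>, y). V \<tau> y) \<in> borel_measurable (borel \<Otimes>\<^sub>M borel)"
    "f \<in> borel_measurable borel"
  shows "(\<lambda>\<tau>. \<integral>\<^sup>+ y\<in>cball z (f \<tau>). V \<tau> y \<partial>lborel) \<in> borel_measurable borel"
proof -
  have "(\<lambda>\<tau>. \<integral>\<^sup>+ y\<in>cball z (f \<tau>). V \<tau> y \<partial>lborel)
      = (\<lambda>\<tau>. \<integral>\<^sup>+ y. (if dist z y \<le> f \<tau> then V \<tau> y else 0) \<partial>lborel)"
    by (intro ext nn_integral_cong) (auto split: split_indicator)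
  also have "\<dots> \<in> borel_measurable borel" by measurable
  finally show ?thesis .
qed

text \<open>
  Duhamel's formula integrated over the parabolic ball at time \<open>t\<close>. The ball that
  carries the initial mass and the parabolic balls at the earlier times lie inside it, and the
  diffusion times \<open>(t - \<tau>) powr \<alpha>\<close> do not exceed its squared radius
  \<open>t powr \<alpha>\<close>, so \<open>heat_average_ball_ge\<close> applies to both terms. The
  factor \<open>(t - \<tau>) powr (\<alpha> - 1)\<close> is bounded below by \<open>T powr (\<alpha>
  - 1)\<close> to make the integrand independent of \<open>t\<close>.
\<close>

lemma mild_solution_mass_ge:
  fixes u :: "real \<Rightarrow> real ^ 'n \<Rightarrow> real"
  assumes \<alpha>: "0 < \<alpha>" "\<alpha> < 1" and c: "0 < c"
    "ennreal c \<le> (\<integral>\<^sup>+ \<theta>\<in>{0<..2}. ennreal (\<theta> * subordination_density \<alpha> \<theta>) \<partial>lborel)"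
    and sol: "mild_solution \<alpha> p u0 (ereal T) u"
    and u0: "u0 \<in> borel_measurable lebesgue" "\<And>x. 0 \<le> u0 x"
    and V [measurable]: "(\<lambda>(\<tau>, y). V \<tau> y) \<in> borel_measurable (borel \<Otimes>\<^sub>M borel)"
    and uV: "AE \<tau> in lborel. \<tau> \<in> {0<..<T} \<longrightarrow> (AE y in lborel. ennreal (u \<tau> y powr p) = V \<tau> y)"
    and \<rho>: "0 < \<rho>" and t: "\<rho> powr (2 / \<alpha>) < t" "t < T"
  shows "ennreal (heat_ball_const TYPE('n) * c / 2) * (\<integral>\<^sup>+ y\<in>cball z \<rho>. ennreal (u0 y) \<partial>lborel)
      + (\<integral>\<^sup>+ \<tau>\<in>{\<rho> powr (2 / \<alpha>)<..<t}. ennreal (\<alpha> * T powr (\<alpha> - 1) * (heat_ball_const TYPE('n) * c))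
          * (\<integral>\<^sup>+ y\<in>cball z (\<tau> powr (\<alpha> / 2)). V \<tau> y \<partial>lborel) \<partial>lborel)
    \<le> (\<integral>\<^sup>+ x\<in>cball z (t powr (\<alpha> / 2)). ennreal (u t x) \<partial>lborel)"
proof -
  let ?k = "heat_ball_const TYPE('n)" and ?r = "\<rho> powr (2 / \<alpha>)" and ?h = "subordination_density \<alpha>"
  define R where "R = t powr (\<alpha> / 2)"
  let ?B = "cball z R"
  have [measurable]: "?B \<in> sets borel" by simp
  have r: "0 < ?r" "0 < t" using \<rho> t by (auto intro: less_trans[of 0 ?r])
  have k: "0 < ?k" by (rule heat_ball_const_pos)
  have R: "0 \<le> R" "R\<^sup>2 = t powr \<alpha>" using r by (simp_all add: R_def power2_eq_square powr_add[symmetric])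
  have \<rho>R: "\<rho> \<le> R"
    using powr_mono2[of "\<alpha> / 2" ?r t] t(1) r \<alpha> \<rho> by (simp add: R_def powr_powr)
  define gP where "gP \<theta> = ennreal (?h \<theta>)" for \<theta>
  define gS where "gS \<theta> = ennreal (\<theta> * ?h \<theta>)" for \<theta>
  have [measurable]: "gP \<in> borel_measurable borel" "gS \<in> borel_measurable borel"
    unfolding gP_def gS_def by measurable
  have gS: "ennreal c \<le> (\<integral>\<^sup>+ \<theta>\<in>{0<..2}. gS \<theta> \<partial>lborel)" using c(2) by (simp add: gS_def)
  \<comment> \<open>On \<open>{0<..2}\<close> the weight of \<open>S\<close> is at most twice the weight of \<open>P\<close>.\<close>
  have gP: "ennreal (c / 2) \<le> (\<integral>\<^sup>+ \<theta>\<in>{0<..2}. gP \<theta> \<partial>lborel)"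
  proof -
    have "ennreal 2 * ennreal (c / 2) \<le> (\<integral>\<^sup>+ \<theta>\<in>{0<..2}. gS \<theta> \<partial>lborel)"
      using gS ennreal_mult'[of 2 "c / 2"] by simp
    also have "\<dots> \<le> (\<integral>\<^sup>+ \<theta>. ennreal 2 * (gP \<theta> * indicator {0<..2} \<theta>) \<partial>lborel)"
    proof (rule nn_integral_mono)
      fix \<theta> :: real
      have "gS \<theta> \<le> ennreal 2 * gP \<theta>" if "0 < \<theta>" "\<theta> \<le> 2"
        unfolding gS_def gP_def using that by (simp only: ennreal_mult' less_imp_le) (intro mult_right_mono ennreal_leI, auto)
      then show "gS \<theta> * indicator {0<..2} \<theta> \<le> ennreal 2 * (gP \<theta> * indicator {0<..2} \<theta>)"
        by (auto split: split_indicator)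
    qed
    also have "\<dots> = ennreal 2 * (\<integral>\<^sup>+ \<theta>\<in>{0<..2}. gP \<theta> \<partial>lborel)"
      by (rule nn_integral_cmult) measurable
    finally show ?thesis by (subst (asm) ennreal_mult_le_mult_iff) auto
  qed
  have "(\<lambda>y. ennreal (u0 y)) \<in> borel_measurable lebesgue" using u0(1) by measurable
  then obtain U where U [measurable]: "U \<in> borel_measurable borel" and u0U: "AE y in lborel. ennreal (u0 y) = U y"
    by (rule borel_representative)
  let ?D = "\<lambda>\<tau> x. heat_average gS ((t - \<tau>) powr \<alpha>) (V \<tau>) x"
  have duhamel: "(\<integral>\<^sup>+ \<tau>\<in>{0<..<t}. ennreal ((t - \<tau>) powr (\<alpha> - 1)) * S_op \<alpha> (t - \<tau>) (\<lambda>y. u \<tau> y powr p) x \<partial>lebesgue)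
     = (\<integral>\<^sup>+ \<tau>\<in>{0<..<t}. ennreal ((t - \<tau>) powr (\<alpha> - 1)) * ?D \<tau> x \<partial>lborel)" for x
    unfolding nn_integral_completion
  proof (rule nn_integral_cong_AE, rule eventually_mono[OF uV])
    fix \<tau> assume *: "\<tau> \<in> {0<..<T} \<longrightarrow> (AE y in lborel. ennreal (u \<tau> y powr p) = V \<tau> y)"
    then have "S_op \<alpha> (t - \<tau>) (\<lambda>y. u \<tau> y powr p) x = ?D \<tau> x" if "\<tau> \<in> {0<..<t}"
      using that t S_op_eq_heat_average[of "\<lambda>y. u \<tau> y powr p" "V \<tau>" \<alpha> "t - \<tau>" x]
      by (simp add: gS_def[abs_def])
    then show "ennreal ((t - \<tau>) powr (\<alpha> - 1)) * S_op \<alpha> (t - \<tau>) (\<lambda>y. u \<tau> y powr p) x * indicator {0<..<t} \<tau>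
        = ennreal ((t - \<tau>) powr (\<alpha> - 1)) * ?D \<tau> x * indicator {0<..<t} \<tau>"
      by (auto split: split_indicator)
  qed
  have "AE x in lebesgue. ennreal (u t x) = P_op \<alpha> t u0 x + ennreal \<alpha> *
      (\<integral>\<^sup>+ \<tau>\<in>{0<..<t}. ennreal ((t - \<tau>) powr (\<alpha> - 1)) * S_op \<alpha> (t - \<tau>) (\<lambda>y. u \<tau> y powr p) x \<partial>lebesgue)"
    using sol r t by (simp add: mild_solution_def)
  then have "AE x in lebesgue. ennreal (u t x) = heat_average gP (t powr \<alpha>) U x + ennreal \<alpha> *
      (\<integral>\<^sup>+ \<tau>\<in>{0<..<t}. ennreal ((t - \<tau>) powr (\<alpha> - 1)) * ?D \<tau> x \<partial>lborel)"
    unfolding duhamel P_op_eq_heat_average[OF u0(2) u0U] gP_def[abs_def] .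
  then have "(\<integral>\<^sup>+ x\<in>?B. ennreal (u t x) \<partial>lebesgue) = (\<integral>\<^sup>+ x\<in>?B. (heat_average gP (t powr \<alpha>) U x + ennreal \<alpha> *
      (\<integral>\<^sup>+ \<tau>\<in>{0<..<t}. ennreal ((t - \<tau>) powr (\<alpha> - 1)) * ?D \<tau> x \<partial>lborel)) \<partial>lebesgue)"
    by (intro nn_integral_cong_AE) (auto elim!: eventually_mono)
  also have "\<dots> = (\<integral>\<^sup>+ x. (heat_average gP (t powr \<alpha>) U x * indicator ?B x + ennreal \<alpha> *
      (\<integral>\<^sup>+ \<tau>. ennreal ((t - \<tau>) powr (\<alpha> - 1)) * indicator {0<..<t} \<tau> * (?D \<tau> x * indicator ?B x) \<partial>lborel)) \<partial>lborel)"
    unfolding nn_integral_completion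
    by (intro nn_integral_cong) (auto split: split_indicator intro!: arg_cong[where f="(*) (ennreal \<alpha>)"] nn_integral_cong simp: ac_simps)
  also have "\<dots> = (\<integral>\<^sup>+ x\<in>?B. heat_average gP (t powr \<alpha>) U x \<partial>lborel) + ennreal \<alpha> * (\<integral>\<^sup>+ x.
      (\<integral>\<^sup>+ \<tau>. ennreal ((t - \<tau>) powr (\<alpha> - 1)) * indicator {0<..<t} \<tau> * (?D \<tau> x * indicator ?B x) \<partial>lborel) \<partial>lborel)"
    by (subst nn_integral_add, measurable) (subst nn_integral_cmult, measurable)
  also have "(\<integral>\<^sup>+ x. (\<integral>\<^sup>+ \<tau>. ennreal ((t - \<tau>) powr (\<alpha> - 1)) * indicator {0<..<t} \<tau> * (?D \<tau> x * indicator ?B x) \<partial>lborel) \<partial>lborel)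
      = (\<integral>\<^sup>+ \<tau>. (\<integral>\<^sup>+ x. ennreal ((t - \<tau>) powr (\<alpha> - 1)) * indicator {0<..<t} \<tau> * (?D \<tau> x * indicator ?B x) \<partial>lborel) \<partial>lborel)"
    by (rule lborel_pair.Fubini') measurable
  also have "\<dots> = (\<integral>\<^sup>+ \<tau>. ennreal ((t - \<tau>) powr (\<alpha> - 1)) * indicator {0<..<t} \<tau> * (\<integral>\<^sup>+ x\<in>?B. ?D \<tau> x \<partial>lborel) \<partial>lborel)"
    by (intro nn_integral_cong nn_integral_cmult) measurable
  finally have mass: "(\<integral>\<^sup>+ x\<in>?B. ennreal (u t x) \<partial>lborel) = (\<integral>\<^sup>+ x\<in>?B. heat_average gP (t powr \<alpha>) U x \<partial>lborel)
      + ennreal \<alpha> * (\<integral>\<^sup>+ \<tau>. ennreal ((t - \<tau>) powr (\<alpha> - 1)) * indicator {0<..<t} \<tau> * (\<integral>\<^sup>+ x\<in>?B. ?D \<tau> x \<partial>lborel) \<partial>lborel)"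
    unfolding nn_integral_completion .
  have "ennreal (?k * c / 2) * (\<integral>\<^sup>+ y\<in>cball z \<rho>. ennreal (u0 y) \<partial>lborel)
      = ennreal ?k * ennreal (c / 2) * (\<integral>\<^sup>+ y\<in>cball z \<rho>. U y \<partial>lborel)"
  proof -
    have "(\<integral>\<^sup>+ y\<in>cball z \<rho>. ennreal (u0 y) \<partial>lborel) = (\<integral>\<^sup>+ y\<in>cball z \<rho>. U y \<partial>lborel)"
      using u0U by (intro nn_integral_cong_AE) (auto elim!: eventually_mono)
    then show ?thesis using k c(1) by (simp add: ennreal_mult[symmetric])
  qed
  also have "\<dots> \<le> ennreal ?k * (\<integral>\<^sup>+ \<theta>\<in>{0<..2}. gP \<theta> \<partial>lborel) * (\<integral>\<^sup>+ y\<in>cball z \<rho>. U y \<partial>lborel)"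
    by (intro mult_right_mono mult_left_mono gP) auto
  also have "\<dots> \<le> (\<integral>\<^sup>+ x\<in>?B. heat_average gP (t powr \<alpha>) U x \<partial>lborel)"
    using R r \<rho>R by (intro heat_average_ball_ge) auto
  finally have P: "ennreal (?k * c / 2) * (\<integral>\<^sup>+ y\<in>cball z \<rho>. ennreal (u0 y) \<partial>lborel) \<le> \<dots>" .
  have "(\<integral>\<^sup>+ \<tau>\<in>{?r<..<t}. ennreal (\<alpha> * T powr (\<alpha> - 1) * (?k * c))
          * (\<integral>\<^sup>+ y\<in>cball z (\<tau> powr (\<alpha> / 2)). V \<tau> y \<partial>lborel) \<partial>lborel)
    \<le> (\<integral>\<^sup>+ \<tau>. ennreal \<alpha> * (ennreal ((t - \<tau>) powr (\<alpha> - 1)) * indicator {0<..<t} \<tau> * (\<integral>\<^sup>+ x\<in>?B. ?D \<tau> x \<partial>lborel)) \<partial>lborel)"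
  proof (rule nn_integral_mono)
    fix \<tau>
    let ?I = "\<integral>\<^sup>+ y\<in>cball z (\<tau> powr (\<alpha> / 2)). V \<tau> y \<partial>lborel"
    have "ennreal (\<alpha> * T powr (\<alpha> - 1) * (?k * c)) * ?I
        \<le> ennreal \<alpha> * (ennreal ((t - \<tau>) powr (\<alpha> - 1)) * (\<integral>\<^sup>+ x\<in>?B. ?D \<tau> x \<partial>lborel))"
      if "?r < \<tau>" "\<tau> < t"
    proof -
      have \<tau>: "0 < \<tau>" using that r by linarith
      have "ennreal (\<alpha> * T powr (\<alpha> - 1) * (?k * c)) * ?I
          = ennreal \<alpha> * (ennreal (T powr (\<alpha> - 1)) * (ennreal ?k * ennreal c * ?I))"
        using \<alpha> k c(1) by (simp add: ennreal_mult mult.assoc)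
      also have "\<dots> \<le> ennreal \<alpha> * (ennreal ((t - \<tau>) powr (\<alpha> - 1)) * (\<integral>\<^sup>+ x\<in>?B. ?D \<tau> x \<partial>lborel))"
      proof (intro mult_left_mono mult_mono)
        show "ennreal (T powr (\<alpha> - 1)) \<le> ennreal ((t - \<tau>) powr (\<alpha> - 1))"
          using that t \<tau> \<alpha> by (intro ennreal_leI powr_mono2') auto
        have "ennreal ?k * ennreal c * ?I \<le> ennreal ?k * (\<integral>\<^sup>+ \<theta>\<in>{0<..2}. gS \<theta> \<partial>lborel) * ?I"
          by (intro mult_right_mono mult_left_mono gS) auto
        also have "\<dots> \<le> (\<integral>\<^sup>+ x\<in>?B. ?D \<tau> x \<partial>lborel)"
        proof (rule heat_average_ball_ge)
          show "(t - \<tau>) powr \<alpha> \<le> R\<^sup>2" unfolding R using that \<tau> \<alpha> by (intro powr_mono2) auto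
          show "cball z (\<tau> powr (\<alpha> / 2)) \<subseteq> cball z R"
            unfolding R_def using that \<tau> \<alpha> by (intro subset_cball powr_mono2) auto
        qed (use that R in auto)
        finally show "ennreal ?k * ennreal c * ?I \<le> (\<integral>\<^sup>+ x\<in>?B. ?D \<tau> x \<partial>lborel)" .
      qed auto
      finally show ?thesis .
    qed
    then show "ennreal (\<alpha> * T powr (\<alpha> - 1) * (?k * c)) * ?I * indicator {?r<..<t} \<tau>
        \<le> ennreal \<alpha> * (ennreal ((t - \<tau>) powr (\<alpha> - 1)) * indicator {0<..<t} \<tau> * (\<integral>\<^sup>+ x\<in>?B. ?D \<tau> x \<partial>lborel))"
      using less_trans[OF r(1), of \<tau>] by (auto split: split_indicator)
  qed
  also have "\<dots> = ennreal \<alpha> * (\<integral>\<^sup>+ \<tau>. ennreal ((t - \<tau>) powr (\<alpha> - 1)) * indicator {0<..<t} \<tau> * (\<integral>\<^sup>+ x\<in>?B. ?D \<tau> x \<partial>lborel) \<partial>lborel)"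
    by (rule nn_integral_cmult) measurable
  finally show ?thesis
    unfolding R_def[symmetric] mass by (intro add_mono P)
qed

text \<open>
  The constant is explicit in \<open>c\<close> and in a lower bound \<open>\<alpha>0\<close> of
  \<open>\<alpha>\<close>, so one value serves all orders from \<open>\<alpha>0\<close> on at which
  the density satisfies the bound.
\<close>

lemma mild_solution_mass_le:
  fixes u :: "real \<Rightarrow> real ^ 'n \<Rightarrow> real"
  defines "k \<equiv> heat_ball_const TYPE('n)" and "q \<equiv> 2 / real CARD('n)"
  assumes \<alpha>: "0 < \<alpha>0" "\<alpha>0 \<le> \<alpha>" "\<alpha> < 1" and c: "0 < c"
    "ennreal c \<le> (\<integral>\<^sup>+ \<theta>\<in>{0<..2}. ennreal (\<theta> * subordination_density \<alpha> \<theta>) \<partial>lborel)"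
    and sol: "mild_solution \<alpha> (1 + 2 / real CARD('n)) u0 (ereal T) u"
    and u0: "u0 \<in> borel_measurable lebesgue" "\<And>x. 0 \<le> u0 x"
    and \<rho>: "0 < \<rho>" "\<rho> powr (2 / \<alpha>) < T"
  shows "(\<integral>\<^sup>+ y\<in>cball z \<rho>. ennreal (u0 y) \<partial>lebesgue) \<le> ennreal
    (2 / (k * c) * ((1 - 2 powr (- q)) * (\<alpha>0 * k * c * unit_ball_vol (real CARD('n)) powr (- q))) powr (- real CARD('n) / 2)
      * (T / \<rho> powr (2 / \<alpha>)) powr ((1 - \<alpha>) * real CARD('n) / 2)
      * ln (T / \<rho> powr (2 / \<alpha>)) powr (- real CARD('n) / 2))"
proof -
  let ?N = "real CARD('n)"
  define r where "r = \<rho> powr (2 / \<alpha>)"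
  define \<omega> where "\<omega> = unit_ball_vol ?N"
  have r: "0 < r" "r < T" and T: "0 < T" using \<rho> by (auto simp: r_def intro: less_trans[of 0 "\<rho> powr (2 / \<alpha>)"])
  have \<alpha>0: "0 < \<alpha>" using \<alpha> by simp
  have k: "0 < k" unfolding k_def by (rule heat_ball_const_pos)
  have \<omega>: "0 < \<omega>" by (simp add: \<omega>_def)
  have q: "0 < q" by (simp add: q_def)
  have p: "1 + 2 / ?N = 1 + q" by (simp add: q_def)
  obtain V :: "real \<Rightarrow> real ^ 'n \<Rightarrow> ennreal"
    where V [measurable]: "(\<lambda>(\<tau>, y). V \<tau> y) \<in> borel_measurable (borel \<Otimes>\<^sub>M borel)"
    and uV: "AE \<tau> in lborel. \<tau> \<in> {0<..<T} \<longrightarrow> (AE y in lborel. ennreal (u \<tau> y powr (1 + q)) = V \<tau> y)"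
    by (rule mild_solution_borel_powr[OF sol[unfolded p]])
  define \<Phi> where "\<Phi> \<tau> = ennreal (\<alpha> * T powr (\<alpha> - 1) * (k * c)) *
    (\<integral>\<^sup>+ y\<in>cball z (\<tau> powr (\<alpha> / 2)). V \<tau> y \<partial>lborel)" for \<tau>
  have \<Phi>_meas: "\<Phi> \<in> borel_measurable borel" unfolding \<Phi>_def by measurable
  define m where "m t = enn2real (\<integral>\<^sup>+ x\<in>cball z (t powr (\<alpha> / 2)). ennreal (u t x) \<partial>lborel)" for t
  have u: "0 \<le> u t x" "integrable lebesgue (u t)" if "0 < t" "t < T" for t x
    using sol that by (auto simp: mild_solution_def)
  have m: "(\<integral>\<^sup>+ x\<in>cball z (t powr (\<alpha> / 2)). ennreal (u t x) \<partial>lborel) = ennreal (m t)"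
    if "0 < t" "t < T" for t
  proof -
    have "(\<integral>\<^sup>+ x\<in>cball z (t powr (\<alpha> / 2)). ennreal (u t x) \<partial>lborel) \<le> (\<integral>\<^sup>+ x. ennreal (u t x) \<partial>lebesgue)"
      unfolding nn_integral_completion by (intro nn_integral_mono) (auto split: split_indicator)
    also have "\<dots> < \<infinity>" using u[OF that] by (simp add: integrable_iff_bounded)
    finally show ?thesis by (simp add: m_def)
  qed
  define I where "I = (\<integral>\<^sup>+ y\<in>cball z \<rho>. ennreal (u0 y) \<partial>lborel)"
  have mass: "ennreal (k * c / 2) * I + (\<integral>\<^sup>+ \<tau>\<in>{r<..<t}. \<Phi> \<tau> \<partial>lborel) \<le> ennreal (m t)"
    if "r < t" "t < T" for t
    using mild_solution_mass_ge[OF \<alpha>0 \<alpha>(3) c sol[unfolded p] u0 V uV \<rho>(1), of t z] that m[of t] r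
    unfolding k_def[symmetric] r_def[symmetric] I_def[symmetric] \<Phi>_def by simp
  define M where "M = enn2real I"
  have I: "I = ennreal M"
  proof -
    have "ennreal (k * c / 2) * I \<le> ennreal (m ((r + T) / 2))"
      using mass[of "(r + T) / 2"] r by (intro order_trans[OF _ mass]) auto
    then have "ennreal (k * c / 2) * I \<noteq> \<infinity>" by (auto simp: top_unique)
    then have "I \<noteq> \<infinity>" using k c(1) by (auto simp: ennreal_mult_eq_top_iff)
    then show ?thesis by (simp add: M_def less_top)
  qed
  define Q where "Q = T / r"
  have Q: "1 < Q" "0 < ln Q" using r by (auto simp: Q_def)
  define E where "E = (1 - 2 powr (- q)) * (\<alpha> * k * c * \<omega> powr (- q))"
  define E0 where "E0 = (1 - 2 powr (- q)) * (\<alpha>0 * k * c * \<omega> powr (- q))"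
  have two: "0 < 1 - 2 powr (- q)" using q by (simp add: powr_less_one)
  have E: "0 < E0" "E0 \<le> E"
    unfolding E_def E0_def using \<alpha> k c \<omega> two by (auto intro!: mult_left_mono mult_right_mono mult_pos_pos)
  have "M \<le> 2 / (k * c) * E0 powr (- ?N / 2) * Q powr ((1 - \<alpha>) * ?N / 2) * ln Q powr (- ?N / 2)"
  proof (cases "M = 0")
    case True
    then show ?thesis using k c E by simp
  next
    case False
    then have M: "0 < M" by (simp add: M_def order_less_le)
    define A where "A = k * c / 2 * M"
    have A: "0 < A" using M k c by (simp add: A_def)
    define B where "B = \<alpha> * T powr (\<alpha> - 1) * (k * c) * (\<omega> powr (- q) * r powr (1 - \<alpha>))"
    have B: "0 < B" using \<alpha>0 T k c \<omega> r by (simp add: B_def)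
    have mass': "ennreal A + (\<integral>\<^sup>+ \<tau>\<in>{r<..<t}. \<Phi> \<tau> \<partial>lborel) \<le> ennreal (m t)" if "r < t" "t < T" for t
    proof -
      have "ennreal A = ennreal (k * c / 2) * ennreal M"
        unfolding A_def using k c(1) by (intro ennreal_mult') simp
      then show ?thesis using mass[OF that] I by simp
    qed
    \<comment> \<open>Jensen on the parabolic ball; as \<open>q N = 2\<close>, its volume contributes exactly \<open>\<tau> powr (- \<alpha>)\<close>.\<close>
    have low: "AE \<tau> in lborel. r < \<tau> \<longrightarrow> \<tau> < T \<longrightarrow> ennreal (B * m \<tau> powr (1 + q) / \<tau>) \<le> \<Phi> \<tau>"
    proof (rule eventually_mono[OF uV], intro impI)
      fix \<tau>
      assume *: "\<tau> \<in> {0<..<T} \<longrightarrow> (AE y in lborel. ennreal (u \<tau> y powr (1 + q)) = V \<tau> y)" and \<tau>: "r < \<tau>" "\<tau> < T"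
      have \<tau>0: "0 < \<tau>" using \<tau> r by simp
      let ?B = "cball z (\<tau> powr (\<alpha> / 2))"
      define v where "v = \<omega> * \<tau> powr (\<alpha> / 2 * ?N)"
      have v: "0 < v" "v powr (1 - (1 + q)) = \<omega> powr (- q) * \<tau> powr (- \<alpha>)"
        using \<omega> \<tau>0 by (simp_all add: v_def powr_mult powr_powr q_def)
      have "emeasure lborel ?B = ennreal v"
        using \<tau>0 by (subst emeasure_cball) (auto simp: v_def \<omega>_def powr_powr powr_realpow[symmetric])
      then have vol: "emeasure lebesgue ?B = ennreal v" by simp
      have "ennreal (m \<tau> powr (1 + q) * v powr (1 - (1 + q)))
          \<le> (\<integral>\<^sup>+ y\<in>?B. ennreal (u \<tau> y powr (1 + q)) \<partial>lebesgue)"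
        using u[OF \<tau>0 \<tau>(2)] v(1) q m[OF \<tau>0 \<tau>(2)] vol
        by (intro nn_integral_powr_ge) (auto simp: nn_integral_completion m_def)
      also have "\<dots> = (\<integral>\<^sup>+ y\<in>?B. V \<tau> y \<partial>lborel)"
        unfolding nn_integral_completion using * \<tau>0 \<tau>
        by (intro nn_integral_cong_AE) (auto elim!: eventually_mono)
      finally have J: "ennreal (m \<tau> powr (1 + q) * v powr (1 - (1 + q))) \<le> (\<integral>\<^sup>+ y\<in>?B. V \<tau> y \<partial>lborel)" .
      have "r powr (1 - \<alpha>) / \<tau> \<le> \<tau> powr (1 - \<alpha>) / \<tau>"
        using \<tau> \<tau>0 r \<alpha> by (intro divide_right_mono powr_mono2) auto
      also have "\<dots> = \<tau> powr (- \<alpha>)" using \<tau>0 by (simp add: powr_diff powr_minus field_simps)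
      finally have rt: "r powr (1 - \<alpha>) / \<tau> \<le> \<tau> powr (- \<alpha>)" .
      have "B * m \<tau> powr (1 + q) / \<tau>
          = \<alpha> * T powr (\<alpha> - 1) * (k * c) * (m \<tau> powr (1 + q) * (\<omega> powr (- q) * (r powr (1 - \<alpha>) / \<tau>)))"
        by (simp add: B_def)
      also have "\<dots> \<le> \<alpha> * T powr (\<alpha> - 1) * (k * c) * (m \<tau> powr (1 + q) * v powr (1 - (1 + q)))"
        unfolding v(2) using rt \<alpha>0 k c(1) by (intro mult_left_mono) auto
      finally have "ennreal (B * m \<tau> powr (1 + q) / \<tau>) \<le>
          ennreal (\<alpha> * T powr (\<alpha> - 1) * (k * c)) * ennreal (m \<tau> powr (1 + q) * v powr (1 - (1 + q)))"
        using \<alpha>0 k c(1) by (subst ennreal_mult'[symmetric]) (auto intro: ennreal_leI)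
      also have "\<dots> \<le> \<Phi> \<tau>" unfolding \<Phi>_def by (intro mult_left_mono J) simp
      finally show "ennreal (B * m \<tau> powr (1 + q) / \<tau>) \<le> \<Phi> \<tau>" .
    qed
    have bound: "B * ln (t / r) \<le> A powr (- q) / (1 - 2 powr (- q))" if "r < t" "t < T" for t
      by (rule log_blow_up[OF A B q r(1) \<Phi>_meas low mass' that])
    \<comment> \<open>The solution need not exist at time \<open>T\<close>, so the bound is extended to \<open>t = T\<close> by continuity.\<close>
    have "B * ln Q \<le> A powr (- q) / (1 - 2 powr (- q))"
    proof (rule tendsto_upperbound)
      show "((\<lambda>t. B * ln (t / r)) \<longlongrightarrow> B * ln Q) (at_left T)"
        unfolding Q_def using r T by (intro tendsto_intros) auto
      show "\<forall>\<^sub>F t in at_left T. B * ln (t / r) \<le> A powr (- q) / (1 - 2 powr (- q))"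
        using eventually_at_left_real[OF r(2)] by (rule eventually_mono) (use bound in auto)
    qed simp
    then have "(1 - 2 powr (- q)) * (B * ln Q) \<le> A powr (- q)"
      using two by (simp add: field_simps)
    moreover have "B = \<alpha> * k * c * \<omega> powr (- q) * Q powr (\<alpha> - 1)"
      using r T by (simp add: B_def Q_def powr_divide powr_diff field_simps)
    ultimately have EA: "E * Q powr (\<alpha> - 1) * ln Q \<le> A powr (- q)"
      by (simp add: E_def ac_simps)
    have "A = (A powr (- q)) powr (- ?N / 2)"
      using A by (simp add: powr_powr q_def)
    also have "\<dots> \<le> (E * Q powr (\<alpha> - 1) * ln Q) powr (- ?N / 2)"
      using EA E Q by (intro powr_mono2') (auto intro!: mult_pos_pos)
    also have "\<dots> = E powr (- ?N / 2) * Q powr ((1 - \<alpha>) * ?N / 2) * ln Q powr (- ?N / 2)"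
    proof -
      have "(Q powr (\<alpha> - 1)) powr (- ?N / 2) = Q powr ((1 - \<alpha>) * ?N / 2)"
        unfolding powr_powr by (rule arg_cong[where f = "(powr) Q"]) (simp add: field_simps)
      then show ?thesis using E Q by (simp add: powr_mult)
    qed
    also have "\<dots> \<le> E0 powr (- ?N / 2) * Q powr ((1 - \<alpha>) * ?N / 2) * ln Q powr (- ?N / 2)"
      using E by (intro mult_right_mono powr_mono2') auto
    finally have "2 / (k * c) * A \<le> 2 / (k * c) * (E0 powr (- ?N / 2) * Q powr ((1 - \<alpha>) * ?N / 2) * ln Q powr (- ?N / 2))"
      using k c by (intro mult_left_mono) auto
    then show ?thesis using k c(1) by (simp add: A_def ac_simps)
  qed
  then show ?thesis
    unfolding nn_integral_completion I_def[symmetric] I Q_def E0_def \<omega>_def r_def[symmetric] by (rule ennreal_leI)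
qed

section \<open>Power series of the subordination density\<close>

lemma Gamma_plus1_pos:
  fixes x :: real
  assumes "0 < x"
  shows "Gamma (x + 1) = x * Gamma x"
  using assms nonpos_Ints_nonpos[of x] by (intro Gamma_plus1) auto

text \<open>
  Logarithmic convexity of \<open>Gamma\<close> between \<open>x\<close> and \<open>x + 1\<close>.
\<close>

lemma Gamma_add_le:
  fixes x a :: real
  assumes "0 < x" "0 \<le> a" "a \<le> 1"
  shows "Gamma (x + a) \<le> x powr a * Gamma x"
proof -
  have "(ln \<circ> Gamma) ((1 - a) *\<^sub>R x + a *\<^sub>R (x + 1)) \<le> (1 - a) * (ln \<circ> Gamma) x + a * (ln \<circ> Gamma) (x + 1)"
    using assms by (intro convex_onD[OF log_convex_Gamma_real]) auto
  moreover have "(1 - a) *\<^sub>R x + a *\<^sub>R (x + 1) = x + a" by (simp add: algebra_simps)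
  moreover have "ln (Gamma (x + 1)) = ln x + ln (Gamma x)"
    unfolding Gamma_plus1_pos[OF assms(1)] using assms(1) by (intro ln_mult_pos) auto
  ultimately have "ln (Gamma (x + a)) \<le> ln (Gamma x) + a * ln x"
    by (simp add: algebra_simps)
  also have "\<dots> = ln (x powr a * Gamma x)"
    using assms(1) by (subst ln_mult_pos) (auto simp: ln_powr)
  finally show ?thesis using assms by (subst (asm) ln_le_cancel_iff) auto
qed

text \<open>
  By \<open>Gamma_add_le\<close> the quotient of consecutive terms is at most \<open>\<bar>x\<bar>
  (n + 1) powr (\<alpha> - 1)\<close>, which tends to zero because \<open>\<alpha> < 1\<close>.
\<close>

lemma summable_Gamma_power_series:
  fixes \<alpha> x :: real
  assumes \<alpha>: "0 < \<alpha>" "\<alpha> < 1"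
  shows "summable (\<lambda>k. Gamma (real (Suc k) * \<alpha>) / fact k * x ^ k)"
proof -
  have "(\<lambda>n. \<bar>x\<bar> * real (Suc n) powr (\<alpha> - 1)) \<longlonglongrightarrow> \<bar>x\<bar> * 0"
    using \<alpha> by (intro tendsto_mult tendsto_const tendsto_neg_powr
      filterlim_compose[OF filterlim_real_sequentially filterlim_Suc]) auto
  then have "\<forall>\<^sub>F n in sequentially. \<bar>x\<bar> * real (Suc n) powr (\<alpha> - 1) < 1 / 2"
    by (rule order_tendstoD) simp
  then obtain N where N: "\<And>n. n \<ge> N \<Longrightarrow> \<bar>x\<bar> * real (Suc n) powr (\<alpha> - 1) < 1 / 2"
    by (auto simp: eventually_sequentially)
  show ?thesis
  proof (rule summable_ratio_test[of "1 / 2" N])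
    fix n assume "N \<le> n"
    let ?y = "real (Suc n) * \<alpha>"
    have y: "0 < ?y" using \<alpha> by simp
    have "Gamma (real (Suc (Suc n)) * \<alpha>) = Gamma (?y + \<alpha>)" by (simp add: algebra_simps)
    also have "\<dots> \<le> ?y powr \<alpha> * Gamma ?y" using y \<alpha> by (intro Gamma_add_le) auto
    also have "\<dots> \<le> real (Suc n) powr \<alpha> * Gamma ?y"
      using y \<alpha> by (intro mult_right_mono powr_mono2) (auto intro: mult_left_le less_imp_le)
    finally have "Gamma (real (Suc (Suc n)) * \<alpha>) / real (Suc n) \<le> real (Suc n) powr \<alpha> * Gamma ?y / real (Suc n)"
      by (rule divide_right_mono) simp
    also have "\<dots> = real (Suc n) powr (\<alpha> - 1) * Gamma ?y"
      by (simp add: powr_diff del: of_nat_Suc)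
    finally have "Gamma (real (Suc (Suc n)) * \<alpha>) / real (Suc n) \<le> real (Suc n) powr (\<alpha> - 1) * Gamma ?y" .
    then have "\<bar>x\<bar> * (Gamma (real (Suc (Suc n)) * \<alpha>) / real (Suc n)) \<le> \<bar>x\<bar> * (real (Suc n) powr (\<alpha> - 1) * Gamma ?y)"
      by (intro mult_left_mono) auto
    also have "\<dots> \<le> 1 / 2 * Gamma ?y"
      using N[OF \<open>N \<le> n\<close>] y by (simp only: mult.assoc[symmetric]) (intro mult_right_mono, auto intro: less_imp_le)
    finally have "\<bar>x\<bar> * (Gamma (real (Suc (Suc n)) * \<alpha>) / real (Suc n)) * (\<bar>x\<bar> ^ n / fact n) \<le> 1 / 2 * Gamma ?y * (\<bar>x\<bar> ^ n / fact n)"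
      by (intro mult_right_mono) auto
    moreover have "0 < Gamma (real (Suc (Suc n)) * \<alpha>)" "0 < Gamma ?y" using \<alpha> by (auto intro!: Gamma_real_pos mult_pos_pos)
    ultimately show "norm (Gamma (real (Suc (Suc n)) * \<alpha>) / fact (Suc n) * x ^ Suc n)
        \<le> 1 / 2 * norm (Gamma (real (Suc n) * \<alpha>) / fact n * x ^ n)"
      by (simp add: abs_mult power_abs ac_simps del: of_nat_Suc)
  qed simp
qed

text \<open>
  By the reflection formula the coefficient equals \<open>(- 1) ^ k / (fact k * Gamma (1 - (k + 1)
  \<alpha>))\<close>: the series is Mainardi's M-Wright function.
\<close>

definition wright_coeff :: "real \<Rightarrow> nat \<Rightarrow> real" where
  "wright_coeff \<alpha> k =
     (- 1) ^ k * Gamma (real (Suc k) * \<alpha>) * sin (real (Suc k) * pi * \<alpha>) / (pi * fact k)"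

lemma summable_norm_wright_coeff:
  assumes "0 < \<alpha>" "\<alpha> < 1"
  shows "summable (\<lambda>k. norm (wright_coeff \<alpha> k * x ^ k))"
proof (rule summable_comparison_test'[OF summable_Gamma_power_series[OF assms, of "\<bar>x\<bar>"], of 0])
  fix k :: nat
  let ?G = "Gamma (real (Suc k) * \<alpha>)"
  have G: "0 < ?G" using assms by (auto intro!: Gamma_real_pos mult_pos_pos)
  have "\<bar>sin (real (Suc k) * pi * \<alpha>)\<bar> / pi \<le> 1"
    using abs_sin_le_one[of "real (Suc k) * pi * \<alpha>"] pi_ge_two
    by (simp only: pos_divide_le_eq[OF pi_gt_zero])
  then have "\<bar>sin (real (Suc k) * pi * \<alpha>)\<bar> / pi * (?G / fact k * \<bar>x\<bar> ^ k) \<le> 1 * (?G / fact k * \<bar>x\<bar> ^ k)"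
    using G by (intro mult_right_mono) auto
  then show "norm (norm (wright_coeff \<alpha> k * x ^ k)) \<le> ?G / fact k * \<bar>x\<bar> ^ k"
    using G by (simp add: wright_coeff_def abs_mult power_abs ac_simps del: of_nat_Suc)
qed

text \<open>
  Substituting \<open>\<theta> powr (- 1 / \<alpha>)\<close> turns the fractional powers of the
  stable density into integer powers of \<open>\<theta>\<close>.
\<close>

lemma subordination_density_eq_wright:
  assumes \<alpha>: "0 < \<alpha>" "\<alpha> < 1" and \<theta>: "0 < \<theta>"
  shows "subordination_density \<alpha> \<theta> = (\<Sum>k. wright_coeff \<alpha> k * \<theta> ^ k)"
proof -
  let ?K = "pi * \<alpha> * \<theta> powr (1 + 1 / \<alpha>)"
  have term_eq: "(- 1) ^ k * (\<theta> powr (- 1 / \<alpha>)) powr (- real (Suc k) * \<alpha> - 1)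
       * (Gamma (real (Suc k) * \<alpha> + 1) / fact (Suc k)) * sin (real (Suc k) * pi * \<alpha>)
      = ?K * (wright_coeff \<alpha> k * \<theta> ^ k)" for k
  proof -
    have "(\<theta> powr (- 1 / \<alpha>)) powr (- real (Suc k) * \<alpha> - 1) = \<theta> powr (real k + (1 + 1 / \<alpha>))"
      unfolding powr_powr using \<alpha> by (intro arg_cong[where f = "(powr) \<theta>"]) (simp add: field_simps)
    also have "\<dots> = \<theta> ^ k * \<theta> powr (1 + 1 / \<alpha>)"
      using \<theta> by (subst powr_add) (simp add: powr_realpow)
    finally have 1: "(\<theta> powr (- 1 / \<alpha>)) powr (- real (Suc k) * \<alpha> - 1) = \<theta> ^ k * \<theta> powr (1 + 1 / \<alpha>)" .
    have "Gamma (real (Suc k) * \<alpha> + 1) = real (Suc k) * \<alpha> * Gamma (real (Suc k) * \<alpha>)"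
      using \<alpha> by (intro Gamma_plus1_pos) simp
    then have 2: "Gamma (real (Suc k) * \<alpha> + 1) / fact (Suc k) = \<alpha> * Gamma (real (Suc k) * \<alpha>) / fact k"
      by (simp add: fact_Suc del: of_nat_Suc)
    show ?thesis unfolding 1 2 by (simp add: wright_coeff_def del: of_nat_Suc)
  qed
  have "summable (\<lambda>k. wright_coeff \<alpha> k * \<theta> ^ k)"
    using summable_norm_wright_coeff[OF \<alpha>] by (rule summable_norm_cancel)
  then have "stable_density \<alpha> (\<theta> powr (- 1 / \<alpha>)) = 1 / pi * (?K * (\<Sum>k. wright_coeff \<alpha> k * \<theta> ^ k))"
    unfolding stable_density_def term_eq by (simp add: suminf_mult)
  moreover have "\<theta> powr (- 1 - 1 / \<alpha>) * \<theta> powr (1 + 1 / \<alpha>) = 1"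
    using \<theta> by (subst powr_add[symmetric]) simp
  ultimately show ?thesis
    using \<alpha> by (simp add: subordination_density_def)
qed

definition wright_series :: "real \<Rightarrow> real \<Rightarrow> real" where
  "wright_series \<alpha> x = (\<Sum>k. wright_coeff \<alpha> k * x ^ k)"

lemma isCont_wright_series:
  assumes "0 < \<alpha>" "\<alpha> < 1"
  shows "isCont (wright_series \<alpha>) x"
  unfolding wright_series_def [abs_def]
  by (rule isCont_powser_converges_everywhere)
     (rule summable_norm_cancel[OF summable_norm_wright_coeff[OF assms]])

lemma ennreal_integral_le_nn_integral:
  fixes f :: "'a \<Rightarrow> real"
  assumes "integrable M f"
  shows "ennreal (integral\<^sup>L M f) \<le> (\<integral>\<^sup>+ x. ennreal (f x) \<partial>M)"
proof -
  have "integral\<^sup>L M f \<le> (\<integral>x. max 0 (f x) \<partial>M)"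
    using assms by (intro integral_mono) auto
  then have "ennreal (integral\<^sup>L M f) \<le> ennreal (\<integral>x. max 0 (f x) \<partial>M)" by (rule ennreal_leI)
  also have "\<dots> = (\<integral>\<^sup>+ x. ennreal (max 0 (f x)) \<partial>M)"
    using assms by (intro nn_integral_eq_integral[symmetric]) auto
  also have "\<dots> = (\<integral>\<^sup>+ x. ennreal (f x) \<partial>M)"
    by (intro nn_integral_cong) (auto simp: max_def ennreal_neg)
  finally show ?thesis .
qed

text \<open>
  At zero the series has the value \<open>Gamma \<alpha> sin (\<pi> \<alpha>) / \<pi> > 0\<close>,
  and it is continuous there.
\<close>

lemma subordination_density_moment_pos:
  assumes \<alpha>: "0 < \<alpha>" "\<alpha> < 1"
  shows "\<exists>c>0. ennreal c \<le> (\<integral>\<^sup>+ \<theta>\<in>{0<..2}. ennreal (\<theta> * subordination_density \<alpha> \<theta>) \<partial>lborel)"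
proof -
  define d where "d = wright_series \<alpha> 0 / 2"
  have "wright_series \<alpha> 0 = wright_coeff \<alpha> 0"
    unfolding wright_series_def by (simp add: powser_zero)
  moreover have "0 < sin (pi * \<alpha>)" using \<alpha> by (intro sin_gt_zero) auto
  ultimately have d: "0 < d" using \<alpha> by (simp add: d_def wright_coeff_def)
  have "(wright_series \<alpha> \<longlongrightarrow> wright_series \<alpha> 0) (at 0)"
    using isCont_wright_series[OF \<alpha>] by (simp add: isCont_def)
  then have "\<forall>\<^sub>F x in at 0. d < wright_series \<alpha> x"
    by (rule order_tendstoD) (use d in \<open>simp add: d_def\<close>)
  then obtain e where e: "0 < e" "\<And>x. x \<noteq> 0 \<Longrightarrow> dist x 0 < e \<Longrightarrow> d < wright_series \<alpha> x"
    unfolding eventually_at by auto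
  define b where "b = min 1 (e / 2)"
  have b: "0 < b" "b \<le> 1" "b < e" using e(1) by (auto simp: b_def)
  show ?thesis
  proof (intro exI conjI)
    show "0 < b / 2 * d * (b / 2)" using b d by simp
    have "ennreal (b / 2 * d * (b / 2)) = ennreal (b / 2 * d) * emeasure lborel {b/2..b}"
      using b d by (simp add: ennreal_mult[symmetric])
    also have "\<dots> = (\<integral>\<^sup>+ \<theta>. ennreal (b / 2 * d) * indicator {b/2..b} \<theta> \<partial>lborel)"
      by (simp add: nn_integral_cmult_indicator)
    also have "\<dots> \<le> (\<integral>\<^sup>+ \<theta>\<in>{0<..2}. ennreal (\<theta> * subordination_density \<alpha> \<theta>) \<partial>lborel)"
    proof (rule nn_integral_mono)
      fix \<theta> :: real
      have "b / 2 * d \<le> \<theta> * subordination_density \<alpha> \<theta>" if "\<theta> \<in> {b/2..b}"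
      proof (rule mult_mono)
        show "d \<le> subordination_density \<alpha> \<theta>"
          using that b e(2)[of \<theta>] subordination_density_eq_wright[OF \<alpha>, of \<theta>]
          by (auto simp: wright_series_def dist_norm)
      qed (use that b d in auto)
      then show "ennreal (b / 2 * d) * indicator {b/2..b} \<theta>
          \<le> ennreal (\<theta> * subordination_density \<alpha> \<theta>) * indicator {0<..2} \<theta>"
        using b by (auto split: split_indicator intro: ennreal_leI)
    qed
    finally show "ennreal (b / 2 * d * (b / 2)) \<le> \<dots>" .
  qed
qed

section \<open>Rotation of the contour\<close>

text \<open>
  With \<open>\<sigma> = \<i> * z\<close> the phase is \<open>\<sigma> powr \<alpha>\<close>, with
  the branch that is holomorphic near every nonzero \<open>z\<close> of the closed first quadrant.
  The integrand arises from Hankel's representation of the density, \<open>exp (\<sigma> - \<theta>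
  \<sigma> powr \<alpha>) \<sigma> powr (\<alpha> - 1) d\<sigma>\<close>, by integrating it in
  \<open>\<theta>\<close> against the hat function, whose Laplace transform at \<open>w\<close> is
  \<open>((1 - exp (- w)) / w)\<^sup>2\<close>.
\<close>

definition wright_phase :: "real \<Rightarrow> complex \<Rightarrow> complex" where
  "wright_phase \<alpha> z = cis (pi * \<alpha> / 2) * z powr of_real \<alpha>"

definition wright_integrand :: "real \<Rightarrow> complex \<Rightarrow> complex" where
  "wright_integrand \<alpha> z =
     exp (\<i> * z) * (1 - exp (- wright_phase \<alpha> z))\<^sup>2 / (wright_phase \<alpha> z * z)"

lemma wright_phase_polar:
  assumes "z \<noteq> 0"
  shows "wright_phase \<alpha> z = rcis (norm z powr \<alpha>) (\<alpha> * (pi / 2 + Arg z))"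
proof -
  have "z powr of_real \<alpha> = exp (of_real \<alpha> * (of_real (ln (norm z)) + \<i> * of_real (Arg z)))"
    using assms by (simp add: powr_def Ln_Arg)
  also have "\<dots> = of_real (norm z powr \<alpha>) * cis (\<alpha> * Arg z)"
    using assms by (simp add: distrib_left exp_add powr_def exp_of_real[symmetric] cis_conv_exp mult.left_commute)
  finally show ?thesis
    by (simp add: wright_phase_def rcis_def cis_mult algebra_simps)
qed

lemma norm_wright_phase: "z \<noteq> 0 \<Longrightarrow> norm (wright_phase \<alpha> z) = norm z powr \<alpha>"
  by (simp add: wright_phase_polar)

text \<open>
  In the first quadrant \<open>\<i> * z\<close> has an argument between \<open>\<pi> / 2\<close> and
  \<open>\<pi>\<close>. Multiplying it by \<open>\<alpha> \<le> 1\<close> increases the cosine, so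
  the real part of the phase is at least \<open>norm z powr (\<alpha> - 1)\<close> times that of
  \<open>\<i> * z\<close>.
\<close>

lemma Re_wright_phase_ge:
  assumes \<alpha>: "0 < \<alpha>" "\<alpha> \<le> 1" and z: "z \<noteq> 0" "0 \<le> Re z" "0 \<le> Im z"
  shows "- (norm z powr (\<alpha> - 1) * Im z) \<le> Re (wright_phase \<alpha> z)"
proof -
  have arg: "0 \<le> Arg z" "Arg z \<le> pi / 2"
    using z Re_Ln_pos_le[of z] Im_Ln_pos_le[of z] by (auto simp: Arg_eq_Im_Ln)
  have "cos (pi / 2 + Arg z) \<le> cos (\<alpha> * (pi / 2 + Arg z))"
    using \<alpha> arg by (intro cos_monotone_0_pi_le) (auto intro!: mult_nonneg_nonneg mult_left_le_one_le)
  then have "- sin (Arg z) \<le> cos (\<alpha> * (pi / 2 + Arg z))"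
    by (simp add: cos_add)
  then have "norm z powr \<alpha> * - sin (Arg z) \<le> norm z powr \<alpha> * cos (\<alpha> * (pi / 2 + Arg z))"
    by (intro mult_left_mono) auto
  moreover have "Im z = norm z * sin (Arg z)"
    using z(1) by (metis Im_rcis rcis_cmod_Arg)
  ultimately show ?thesis
    using z(1) by (simp add: wright_phase_polar powr_diff)
qed

lemma norm_one_minus_exp_le:
  fixes w :: complex
  assumes "- Re w \<le> b" "0 \<le> b"
  shows "norm (1 - exp (- w)) \<le> norm w * exp b"
proof -
  let ?S = "closed_segment 0 (- w)"
  have b: "norm (exp \<xi>) \<le> exp b" if \<xi>: "\<xi> \<in> ?S" for \<xi>
  proof -
    obtain s where s: "0 \<le> s" "s \<le> 1" "\<xi> = (1 - s) *\<^sub>R 0 + s *\<^sub>R (- w)"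
      using \<xi> unfolding in_segment by auto
    then have "Re \<xi> = s * (- Re w)" by simp
    also have "\<dots> \<le> s * b" using s assms(1) by (intro mult_left_mono) auto
    also have "\<dots> \<le> b" using s assms(2) by (intro mult_left_le_one_le) auto
    finally show ?thesis by simp
  qed
  have "norm (exp 0 - exp (- w)) \<le> exp b * norm (0 - (- w))"
    by (rule field_differentiable_bound[of ?S exp exp])
       (use b in \<open>auto intro!: derivative_eq_intros\<close>)
  then show ?thesis by (simp add: mult.commute)
qed

text \<open>
  The first bound uses the size of \<open>1 - exp (- w)\<close> and gives the decay at infinity; the
  second uses that it is at most of the order of \<open>w\<close> and gives an integrable
  singularity at zero. On the positive real axis the factor \<open>E\<close> equals one. In the
  interior, growth of \<open>exp (- wright_phase \<alpha> z)\<close> is compensated by \<open>exp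
  (\<i> * z)\<close> as soon as \<open>2 * norm z powr (\<alpha> - 1) \<le> 1\<close>.
\<close>

lemma norm_wright_integrand_le:
  assumes \<alpha>: "0 < \<alpha>" "\<alpha> \<le> 1" and z: "z \<noteq> 0" "0 \<le> Re z" "0 \<le> Im z"
  defines "E \<equiv> exp ((2 * norm z powr (\<alpha> - 1) - 1) * Im z)"
  shows "norm (wright_integrand \<alpha> z) \<le> 4 * norm z powr (- 1 - \<alpha>) * E"
    and "norm (wright_integrand \<alpha> z) \<le> norm z powr (\<alpha> - 1) * E"
proof -
  let ?w = "wright_phase \<alpha> z" and ?b = "norm z powr (\<alpha> - 1) * Im z"
  have b: "0 \<le> ?b" "- Re ?w \<le> ?b" using z Re_wright_phase_ge[OF \<alpha> z] by auto
  have w: "norm ?w = norm z powr \<alpha>" using z(1) by (rule norm_wright_phase)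
  have E: "E = exp (- Im z) * (exp ?b)\<^sup>2"
    by (simp add: E_def exp_add[symmetric] power2_eq_square algebra_simps)
  have F: "norm (wright_integrand \<alpha> z) = exp (- Im z) * (norm (1 - exp (- ?w)))\<^sup>2 / (norm z powr \<alpha> * norm z)"
    by (simp add: wright_integrand_def norm_mult norm_divide norm_power w)
  have "norm (1 - exp (- ?w)) \<le> 1 + exp (- Re ?w)"
    using norm_triangle_ineq4[of 1 "exp (- ?w)"] by simp
  also have "\<dots> \<le> exp ?b + exp ?b" using b by (intro add_mono) auto
  finally have "(norm (1 - exp (- ?w)))\<^sup>2 \<le> (2 * exp ?b)\<^sup>2" by (intro power_mono) auto
  then have "exp (- Im z) * (norm (1 - exp (- ?w)))\<^sup>2 / (norm z powr \<alpha> * norm z)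
      \<le> exp (- Im z) * (2 * exp ?b)\<^sup>2 / (norm z powr \<alpha> * norm z)"
    by (intro divide_right_mono mult_left_mono) auto
  also have "\<dots> = 4 * norm z powr (- 1 - \<alpha>) * E"
    using z(1) by (simp add: E powr_diff powr_minus field_simps power_mult_distrib)
  finally show "norm (wright_integrand \<alpha> z) \<le> 4 * norm z powr (- 1 - \<alpha>) * E" unfolding F .
  have "(norm (1 - exp (- ?w)))\<^sup>2 \<le> (norm ?w * exp ?b)\<^sup>2"
    using b by (intro power_mono norm_one_minus_exp_le) auto
  then have "exp (- Im z) * (norm (1 - exp (- ?w)))\<^sup>2 / (norm z powr \<alpha> * norm z)
      \<le> exp (- Im z) * (norm ?w * exp ?b)\<^sup>2 / (norm z powr \<alpha> * norm z)"
    by (intro divide_right_mono mult_left_mono) auto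
  also have "\<dots> = norm z powr (\<alpha> - 1) * E"
    using z(1) by (simp add: E w powr_diff field_simps power_mult_distrib power2_eq_square)
  finally show "norm (wright_integrand \<alpha> z) \<le> norm z powr (\<alpha> - 1) * E" unfolding F .
qed

lemma holomorphic_wright_integrand:
  "wright_integrand \<alpha> holomorphic_on {z. 0 < Re z + Im z}"
proof -
  have "z \<notin> \<real>\<^sub>\<le>\<^sub>0" if "0 < Re z + Im z" for z
    using that by (auto simp: complex_nonpos_Reals_iff)
  then show ?thesis
    unfolding wright_integrand_def wright_phase_def
    by (intro holomorphic_intros) auto
qed

text \<open>
  The two rays are joined by chords instead of arcs: a chord is convex, so the mean value inequality
  bounds the increment of a primitive along it by the supremum of the integrand.
\<close>

lemma wright_primitive_chord_le:
  assumes g: "\<And>z. 0 < Re z + Im z \<Longrightarrow> (g has_field_derivative wright_integrand \<alpha> z) (at z)"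
    and R: "0 < R" and z: "\<And>z. z \<in> closed_segment (of_real R) (\<i> * of_real R) \<Longrightarrow> norm (wright_integrand \<alpha> z) \<le> b"
  shows "norm (g (\<i> * of_real R) - g (of_real R)) \<le> 2 * b * R"
proof -
  let ?S = "closed_segment (of_real R) (\<i> * of_real R :: complex)"
  have S: "Re x + Im x = R" if x: "x \<in> ?S" for x
  proof -
    obtain s where "x = (1 - s) *\<^sub>R of_real R + s *\<^sub>R (\<i> * of_real R)"
      using x unfolding in_segment by blast
    then have "Re x = (1 - s) * R" "Im x = s * R" by simp_all
    then show ?thesis by (simp add: algebra_simps)
  qed
  have "0 \<le> b" using order_trans[OF norm_ge_zero z[of "of_real R"]] by simp
  have "norm (g (\<i> * of_real R) - g (of_real R)) \<le> b * norm (\<i> * of_real R - of_real R :: complex)"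
    by (rule field_differentiable_bound[of ?S g "wright_integrand \<alpha>"])
       (use S R in \<open>auto intro!: z has_field_derivative_at_within g\<close>)
  also have "\<dots> \<le> b * (R + R)"
    using R norm_triangle_ineq4[of "\<i> * of_real R" "of_real R :: complex"] \<open>0 \<le> b\<close>
    by (intro mult_left_mono) (auto simp: norm_mult)
  finally show ?thesis by (simp add: algebra_simps)
qed

lemma chord_bounds:
  assumes R: "0 < R" and z: "z \<in> closed_segment (of_real R) (\<i> * of_real R :: complex)"
  shows "0 \<le> Re z" "0 \<le> Im z" "R / 2 \<le> norm z" "norm z \<le> R" "z \<noteq> 0"
proof -
  obtain s where s: "0 \<le> s" "s \<le> 1" "z = (1 - s) *\<^sub>R of_real R + s *\<^sub>R (\<i> * of_real R)"
    using z unfolding in_segment by auto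
  have re: "Re z = (1 - s) * R" "Im z = s * R" using s by simp_all
  show *: "0 \<le> Re z" "0 \<le> Im z" using re s R by auto
  have sum: "Re z + Im z = R" using re by (simp add: algebra_simps)
  show "norm z \<le> R" using cmod_le[of z] * sum by simp
  show "R / 2 \<le> norm z" using complex_Re_le_cmod[of z] abs_Im_le_cmod[of z] * sum by linarith
  then show "z \<noteq> 0" using R by auto
qed

lemma wright_primitive_at_infinity:
  assumes \<alpha>: "0 < \<alpha>" "\<alpha> < 1"
    and g: "\<And>z. 0 < Re z + Im z \<Longrightarrow> (g has_field_derivative wright_integrand \<alpha> z) (at z)"
  shows "((\<lambda>R. g (\<i> * of_real R) - g (of_real R)) \<longlongrightarrow> 0) at_top"
proof (rule Lim_null_comparison)
  have "\<forall>\<^sub>F R in at_top. (R / 2) powr (\<alpha> - 1) < 1 / 2"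
  proof (rule order_tendstoD)
    show "((\<lambda>R. (R / 2 :: real) powr (\<alpha> - 1)) \<longlongrightarrow> 0) at_top" using \<alpha> by real_asymp
  qed simp
  then show "\<forall>\<^sub>F R in at_top. norm (g (\<i> * of_real R) - g (of_real R)) \<le> 2 * (4 * (R / 2) powr (- 1 - \<alpha>)) * R"
    using eventually_gt_at_top[of 0]
  proof eventually_elim
    case (elim R)
    show ?case
    proof (rule wright_primitive_chord_le[OF g elim(2)])
      fix z assume "z \<in> closed_segment (of_real R) (\<i> * of_real R :: complex)"
      note z = chord_bounds[OF elim(2) this]
      have "norm z powr (\<alpha> - 1) \<le> (R / 2) powr (\<alpha> - 1)"
        using z elim \<alpha> by (intro powr_mono2') auto
      then have "(2 * norm z powr (\<alpha> - 1) - 1) * Im z \<le> 0"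
        using z elim by (intro mult_nonpos_nonneg) auto
      then have "4 * norm z powr (- 1 - \<alpha>) * exp ((2 * norm z powr (\<alpha> - 1) - 1) * Im z) \<le> 4 * norm z powr (- 1 - \<alpha>) * 1"
        by (intro mult_left_mono) auto
      with norm_wright_integrand_le(1)[OF \<alpha>(1) less_imp_le[OF \<alpha>(2)] z(5,1,2)]
      have "norm (wright_integrand \<alpha> z) \<le> 4 * norm z powr (- 1 - \<alpha>) * 1"
        by (rule order_trans)
      also have "\<dots> \<le> 4 * (R / 2) powr (- 1 - \<alpha>)"
        using z elim \<alpha> by (simp, intro powr_mono2') auto
      finally show "norm (wright_integrand \<alpha> z) \<le> 4 * (R / 2) powr (- 1 - \<alpha>)" .
    qed
  qed
  show "((\<lambda>R. 2 * (4 * (R / 2) powr (- 1 - \<alpha>)) * R) \<longlongrightarrow> 0) at_top"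
    using \<alpha> by real_asymp
qed

lemma wright_primitive_at_zero:
  assumes \<alpha>: "0 < \<alpha>" "\<alpha> < 1"
    and g: "\<And>z. 0 < Re z + Im z \<Longrightarrow> (g has_field_derivative wright_integrand \<alpha> z) (at z)"
  shows "((\<lambda>R. g (\<i> * of_real R) - g (of_real R)) \<longlongrightarrow> 0) (at_right 0)"
proof (rule Lim_null_comparison)
  have "\<forall>\<^sub>F R in at_right (0::real). R \<in> {0<..<1}"
    by (rule eventually_at_right_real) simp
  then show "\<forall>\<^sub>F R in at_right 0. norm (g (\<i> * of_real R) - g (of_real R)) \<le> 2 * ((R / 2) powr (\<alpha> - 1) * exp 2) * R"
  proof eventually_elim
    case (elim R)
    then have R: "0 < R" "R < 1" by auto
    show ?case
    proof (rule wright_primitive_chord_le[OF g R(1)])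
      fix z assume "z \<in> closed_segment (of_real R) (\<i> * of_real R :: complex)"
      note z = chord_bounds[OF R(1) this]
      have "norm z powr (\<alpha> - 1) * Im z \<le> norm z powr (\<alpha> - 1) * norm z"
        using abs_Im_le_cmod[of z] by (intro mult_left_mono) auto
      also have "\<dots> = norm z powr \<alpha>" using z by (simp add: powr_diff)
      also have "\<dots> \<le> 1" using z R \<alpha> by (intro powr_le1) auto
      finally have "(2 * norm z powr (\<alpha> - 1) - 1) * Im z \<le> 2"
        using z by (simp add: algebra_simps)
      then have "norm z powr (\<alpha> - 1) * exp ((2 * norm z powr (\<alpha> - 1) - 1) * Im z) \<le> norm z powr (\<alpha> - 1) * exp 2"
        by (intro mult_left_mono) auto
      with norm_wright_integrand_le(2)[OF \<alpha>(1) less_imp_le[OF \<alpha>(2)] z(5,1,2)]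
      have "norm (wright_integrand \<alpha> z) \<le> norm z powr (\<alpha> - 1) * exp 2"
        by (rule order_trans)
      also have "\<dots> \<le> (R / 2) powr (\<alpha> - 1) * exp 2"
        using z R \<alpha> by (intro mult_right_mono powr_mono2') auto
      finally show "norm (wright_integrand \<alpha> z) \<le> (R / 2) powr (\<alpha> - 1) * exp 2" .
    qed
  qed
  show "((\<lambda>R. 2 * ((R / 2) powr (\<alpha> - 1) * exp 2) * R) \<longlongrightarrow> 0) (at_right 0)"
    using \<alpha> by real_asymp
qed

text \<open>
  The integrand is holomorphic on a half plane that contains both rays, and so has a primitive
  there. The integrals over \<open>[1 / n, n]\<close> along the two rays differ by the increments of
  the primitive along two chords, which vanish in the limit.
\<close>

lemma wright_contour_rotation:
  assumes \<alpha>: "0 < \<alpha>" "\<alpha> < 1"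
    and int1: "set_integrable lborel {0<..} (\<lambda>r::real. wright_integrand \<alpha> (of_real r))"
    and int2: "set_integrable lborel {0<..} (\<lambda>r::real. \<i> * wright_integrand \<alpha> (\<i> * of_real r))"
  shows "(LINT r:{0<..}|lborel. \<i> * wright_integrand \<alpha> (\<i> * of_real r))
       = (LINT r:{0<..}|lborel. wright_integrand \<alpha> (of_real r))"
proof -
  let ?S = "{z. 0 < Re z + Im z}" and ?F = "wright_integrand \<alpha>"
  have S: "?S = {z. (1 + \<i>) \<bullet> z > 0}" by (auto simp: inner_complex_def)
  have S': "convex ?S" "open ?S" unfolding S by (auto simp: convex_halfspace_gt open_halfspace_gt)
  have "\<exists>g. \<forall>z\<in>?S. (g has_field_derivative ?F z) (at z within ?S)"
  proof (rule holomorphic_convex_primitive'[OF S' holomorphic_wright_integrand[of \<alpha>]])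
    fix g assume "\<And>z. z \<in> ?S \<Longrightarrow> (g has_field_derivative ?F z) (at z within ?S)"
    then have "\<forall>z\<in>?S. (g has_field_derivative ?F z) (at z within ?S)" by (intro ballI)
    then show "\<exists>g. \<forall>z\<in>?S. (g has_field_derivative ?F z) (at z within ?S)" by (intro exI[of _ g])
  qed
  then obtain g where g': "\<forall>z\<in>?S. (g has_field_derivative ?F z) (at z within ?S)" by (rule exE)
  have g: "(g has_field_derivative ?F z) (at z)" if "0 < Re z + Im z" for z
  proof -
    have z: "z \<in> ?S" using that by simp
    show ?thesis using bspec[OF g' z] unfolding at_within_open[OF z S'(2)] .
  qed
  define I where "I n = {inverse (real (Suc n))..real (Suc n)}" for n
  have cont: "continuous_on ?S ?F"
    by (rule holomorphic_on_imp_continuous_on[OF holomorphic_wright_integrand])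
  have I0: "0 < r" if "r \<in> I n" for n r
    using that by (auto simp: I_def intro: less_le_trans[of 0 "inverse (real (Suc n))"])
  have leI: "inverse (real (Suc n)) \<le> real (Suc n)" for n
    by (rule order_trans[of _ 1]) (simp_all add: inverse_le_1_iff)
  have ray: "((\<lambda>r. c * of_real r) has_vector_derivative c) (at r)" for c :: complex and r :: real
    by (auto intro!: derivative_eq_intros simp: has_vector_derivative_def scaleR_conv_of_real)
  have line1: "(LINT r:I n|lborel. ?F (of_real r)) = g (of_real (real (Suc n))) - g (of_real (inverse (real (Suc n))))" for n
    unfolding set_lebesgue_integral_def I_def
  proof (rule integral_FTC_Icc[OF leI])
    fix r assume r: "inverse (real (Suc n)) \<le> r" "r \<le> real (Suc n)"
    then have "0 < r" using I0[of r n] by (simp add: I_def)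
    then have "(g has_field_derivative ?F (1 * of_real r)) (at (1 * of_real r))" by (intro g) simp
    from field_vector_diff_chain_at[OF ray this]
    have "((\<lambda>r. g (of_real r)) has_vector_derivative ?F (of_real r)) (at r)" by (simp add: o_def)
    then show "((\<lambda>r. g (of_real r)) has_vector_derivative ?F (of_real r)) (at r within {inverse (real (Suc n))..real (Suc n)})"
      by (auto intro: has_vector_derivative_at_within)
  next
    show "continuous_on {inverse (real (Suc n))..real (Suc n)} (\<lambda>r. ?F (of_real r))"
      by (rule continuous_on_compose2[OF cont]) (use I0[of _ n] in \<open>auto intro!: continuous_intros simp: I_def\<close>)
  qed
  have line2: "(LINT r:I n|lborel. \<i> * ?F (\<i> * of_real r)) = g (\<i> * of_real (real (Suc n))) - g (\<i> * of_real (inverse (real (Suc n))))" for n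
    unfolding set_lebesgue_integral_def I_def
  proof (rule integral_FTC_Icc[OF leI])
    fix r assume r: "inverse (real (Suc n)) \<le> r" "r \<le> real (Suc n)"
    then have "0 < r" using I0[of r n] by (simp add: I_def)
    then have "(g has_field_derivative ?F (\<i> * of_real r)) (at (\<i> * of_real r))" by (intro g) simp
    from field_vector_diff_chain_at[OF ray this]
    have "((\<lambda>r. g (\<i> * of_real r)) has_vector_derivative \<i> * ?F (\<i> * of_real r)) (at r)" by (simp add: o_def)
    then show "((\<lambda>r. g (\<i> * of_real r)) has_vector_derivative \<i> * ?F (\<i> * of_real r)) (at r within {inverse (real (Suc n))..real (Suc n)})"
      by (auto intro: has_vector_derivative_at_within)
  next
    show "continuous_on {inverse (real (Suc n))..real (Suc n)} (\<lambda>r. \<i> * ?F (\<i> * of_real r))"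
      by (intro continuous_intros continuous_on_compose2[OF cont]) (use I0[of _ n] in \<open>auto intro!: continuous_intros simp: I_def\<close>)
  qed
  have UN: "(\<Union>n. I n) = {0<..}"
  proof (intro equalityI subsetI)
    fix r :: real assume "r \<in> {0<..}"
    then have r: "0 < r" by simp
    obtain n where n: "max r (inverse r) < real n" using reals_Archimedean2 by blast
    then have "inverse (real (Suc n)) \<le> r" using r
      by (subst inverse_inverse_eq[of r, symmetric], intro le_imp_inverse_le) auto
    then show "r \<in> (\<Union>n. I n)" using n by (auto simp: I_def intro!: exI[of _ n])
  qed (use I0 in auto)
  have inc: "incseq I"
    unfolding incseq_def I_def by (auto intro: order_trans[rotated] le_imp_inverse_le)
  have lim1: "(\<lambda>n. LINT r:I n|lborel. ?F (of_real r)) \<longlonglongrightarrow> (LINT r:{0<..}|lborel. ?F (of_real r))"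
    unfolding UN[symmetric] by (rule set_integral_cont_up) (use int1 inc in \<open>auto simp: UN, simp add: I_def\<close>)
  have lim2: "(\<lambda>n. LINT r:I n|lborel. \<i> * ?F (\<i> * of_real r)) \<longlonglongrightarrow> (LINT r:{0<..}|lborel. \<i> * ?F (\<i> * of_real r))"
    unfolding UN[symmetric] by (rule set_integral_cont_up) (use int2 inc in \<open>auto simp: UN, simp add: I_def\<close>)
  have top: "filterlim (\<lambda>n. real (Suc n)) at_top sequentially"
    by (rule filterlim_compose[OF filterlim_real_sequentially filterlim_Suc])
  have "(\<lambda>n. (g (\<i> * of_real (real (Suc n))) - g (of_real (real (Suc n))))
       - (g (\<i> * of_real (inverse (real (Suc n)))) - g (of_real (inverse (real (Suc n)))))) \<longlonglongrightarrow> 0 - 0"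
    by (intro tendsto_diff filterlim_compose[OF wright_primitive_at_infinity[OF \<alpha> g] top]
      filterlim_compose[OF wright_primitive_at_zero[OF \<alpha> g]]
      filterlim_compose[OF filterlim_inverse_at_right_top top])
  then have "(\<lambda>n. (LINT r:I n|lborel. \<i> * ?F (\<i> * of_real r)) - (LINT r:I n|lborel. ?F (of_real r))) \<longlonglongrightarrow> 0"
    unfolding line1 line2 by (simp add: algebra_simps)
  with tendsto_diff[OF lim2 lim1] show ?thesis
    using LIMSEQ_unique by fastforce
qed

section \<open>The density tested against a hat function\<close>

lemma has_bochner_integral_Gamma:
  assumes "0 < s"
  shows "has_bochner_integral lborel (\<lambda>r::real. indicator {0<..} r *\<^sub>R (r powr (s - 1) / exp r)) (Gamma s)"
proof (rule has_bochner_integral_nn_integral)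
  have "(\<integral>\<^sup>+ r. ennreal (indicator {0<..} r *\<^sub>R (r powr (s - 1) / exp r)) \<partial>lborel)
      = (\<integral>\<^sup>+ r. ennreal (indicator {0..} r * r powr (s - 1) / exp r) \<partial>lborel)"
    by (intro nn_integral_cong) (auto split: split_indicator simp: powr_def)
  then show "(\<integral>\<^sup>+ r. ennreal (indicator {0<..} r *\<^sub>R (r powr (s - 1) / exp r)) \<partial>lborel) = ennreal (Gamma s)"
    using Gamma_conv_nn_integral_real[OF assms] by simp
qed (use assms in \<open>auto intro: less_imp_le\<close>)

text \<open>
  The integral of the hat function times \<open>\<theta> ^ k\<close> is \<open>(2 ^ (k + 2) - 2) /
  ((k + 1) (k + 2))\<close>. With the factor \<open>(- 1) ^ k / fact k\<close> these moments are the
  Taylor coefficients of its Laplace transform.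
\<close>

definition hat_coeff :: "nat \<Rightarrow> real" where
  "hat_coeff k = (- 1) ^ k * (2 ^ (k + 2) - 2) / fact (k + 2)"

lemma hat_coeff_sums:
  fixes w :: complex
  assumes "w \<noteq> 0"
  shows "(\<lambda>k. of_real (hat_coeff k) * w ^ Suc k) sums ((1 - exp (- w))\<^sup>2 / w)"
proof -
  let ?f = "\<lambda>n. (- 2 * w) ^ n /\<^sub>R fact n - 2 * ((- w) ^ n /\<^sub>R fact n)"
  have "?f sums (exp (- 2 * w) - 2 * exp (- w))"
    by (intro sums_diff sums_mult exp_converges)
  moreover have "exp (- 2 * w) - 2 * exp (- w) = ((1 - exp (- w))\<^sup>2) + (\<Sum>n<2. ?f n)"
    by (simp add: power2_eq_square eval_nat_numeral algebra_simps exp_add[symmetric])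
  ultimately have "?f sums ((1 - exp (- w))\<^sup>2 + (\<Sum>n<2. ?f n))"
    by (simp only:)
  then have "(\<lambda>k. ?f (k + 2)) sums ((1 - exp (- w))\<^sup>2)"
    unfolding sums_iff_shift[of ?f 2] .
  then have "(\<lambda>k. ?f (k + 2) / w) sums ((1 - exp (- w))\<^sup>2 / w)" by (rule sums_divide)
  moreover have "?f (k + 2) / w = of_real (hat_coeff k) * w ^ Suc k" for k
  proof -
    have "(- 2 * w) ^ (k + 2) = of_real ((- 1) ^ k * 2 ^ (k + 2)) * (w ^ Suc k * w)"
      by (simp add: power_mult_distrib power_add power_minus[of w] power_minus[of "2 * w"] power2_eq_square)
    moreover have "(- w) ^ (k + 2) = of_real ((- 1) ^ k) * (w ^ Suc k * w)"
      by (simp add: power_add power_minus[of w] power2_eq_square)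
    ultimately have "?f (k + 2) = of_real (hat_coeff k) * (w ^ Suc k * w)"
      by (simp add: hat_coeff_def scaleR_conv_of_real field_simps del: fact_Suc power_Suc)
    then show ?thesis using assms by (simp del: power_Suc)
  qed
  ultimately show ?thesis by simp
qed

lemma abs_hat_coeff_le: "\<bar>hat_coeff k\<bar> \<le> 4 * 2 ^ k / fact k"
proof -
  have "(2::real) ^ 1 \<le> 2 ^ (k + 2)" by (intro power_increasing) auto
  then have "\<bar>hat_coeff k\<bar> = (2 ^ (k + 2) - 2) / fact (k + 2)"
    by (simp add: hat_coeff_def abs_mult)
  also have "\<dots> \<le> 2 ^ (k + 2) / fact k"
    by (intro frac_le fact_mono) auto
  finally show ?thesis by (simp add: power_add)
qed

lemma wright_integrand_imag_axis:
  fixes r \<alpha> :: real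
  assumes r: "0 < r"
  defines "w \<equiv> rcis (r powr \<alpha>) (pi * \<alpha>)"
  shows "\<i> * wright_integrand \<alpha> (\<i> * of_real r) = of_real (inverse (exp r) / r) * ((1 - exp (- w))\<^sup>2 / w)"
proof -
  have "Arg (\<i> * of_real r) = pi / 2"
    using r by (simp add: Arg_times_of_real2)
  then have w: "wright_phase \<alpha> (\<i> * of_real r) = w"
    using r by (simp add: wright_phase_polar w_def norm_mult field_simps)
  have e: "exp (\<i> * (\<i> * of_real r)) = of_real (inverse (exp r))"
    by (simp add: exp_minus exp_of_real[symmetric] mult.assoc[symmetric])
  show ?thesis
    unfolding wright_integrand_def w e by (simp add: field_simps)
qed

text \<open>
  On the imaginary axis the integrand expands into powers of the phase. Times \<open>exp (-
  r)\<close> each term integrates to a value of \<open>Gamma\<close>, and the sum may be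
  interchanged with the integral because \<open>\<Sum>k. 2 ^ k * Gamma ((k + 1) \<alpha>) / fact
  k\<close> converges.
\<close>

lemma wright_integrand_imag_axis_integral:
  assumes \<alpha>: "0 < \<alpha>" "\<alpha> < 1"
  shows "set_integrable lborel {0<..} (\<lambda>r::real. \<i> * wright_integrand \<alpha> (\<i> * of_real r))"
    and "(\<lambda>k. of_real (hat_coeff k * Gamma (real (Suc k) * \<alpha>)) * cis (real (Suc k) * (pi * \<alpha>)))
      sums (LINT r:{0<..}|lborel. \<i> * wright_integrand \<alpha> (\<i> * of_real r))"
proof -
  let ?s = "\<lambda>k. real (Suc k) * \<alpha>"
  define G where "G k r = indicator {0<..} r *\<^sub>R (r powr (?s k - 1) / exp r)" for k and r :: real
  have G: "has_bochner_integral lborel (G k) (Gamma (?s k))" for k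
    unfolding G_def using \<alpha> by (intro has_bochner_integral_Gamma) simp
  define c where "c k = of_real (hat_coeff k) * cis (real (Suc k) * (pi * \<alpha>))" for k
  define T where "T k r = of_real (G k r) * c k" for k r
  have T: "has_bochner_integral lborel (T k) (of_real (Gamma (?s k)) * c k)" for k
    unfolding T_def by (intro has_bochner_integral_mult_left has_bochner_integral_of_real G)
  have G0: "0 \<le> G k r" for k r by (simp add: G_def)
  have normT: "norm (T k r) = \<bar>hat_coeff k\<bar> * G k r" for k r
    using G0[of k r] by (simp add: T_def c_def norm_mult)
  have sums: "(\<lambda>k. T k r) sums (indicator {0<..} r *\<^sub>R (\<i> * wright_integrand \<alpha> (\<i> * of_real r)))"
    and summ: "summable (\<lambda>k. norm (T k r))" for r
  proof -
    have "(\<lambda>k. T k r) sums (indicator {0<..} r *\<^sub>R (\<i> * wright_integrand \<alpha> (\<i> * of_real r))) \<and> summable (\<lambda>k. norm (T k r))"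
    proof (cases "0 < r")
      case False
      then show ?thesis by (simp add: T_def G_def)
    next
      case r: True
      let ?w = "rcis (r powr \<alpha>) (pi * \<alpha>)"
      have powr: "(r powr \<alpha>) ^ Suc k * (1 / r) = r powr (?s k - 1)" for k
        using r by (simp add: powr_diff powr_powr powr_realpow[symmetric] mult.commute del: of_nat_Suc power_Suc)
      have Gr: "G k r = (r powr \<alpha>) ^ Suc k * (inverse (exp r) / r)" for k
        using r powr[of k] by (simp add: G_def field_simps del: of_nat_Suc power_Suc)
      have Tr: "T k r = of_real (inverse (exp r) / r) * (of_real (hat_coeff k) * ?w ^ Suc k)" for k
        unfolding T_def c_def Gr DeMoivre2 by (simp add: rcis_def del: of_nat_Suc power_Suc)
      have "?w \<noteq> 0" using r by simp
      have "(\<lambda>k. T k r) sums (\<i> * wright_integrand \<alpha> (\<i> * of_real r))"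
        unfolding Tr wright_integrand_imag_axis[OF r]
        by (intro sums_mult hat_coeff_sums \<open>?w \<noteq> 0\<close>)
      moreover have "summable (\<lambda>k. norm (T k r))"
      proof (rule summable_comparison_test')
        show "summable (\<lambda>k. 4 * r powr \<alpha> * inverse (exp r) / r * (inverse (fact k) * (2 * r powr \<alpha>) ^ k))"
          by (intro summable_mult summable_exp)
        fix k :: nat
        have "\<bar>hat_coeff k\<bar> * G k r \<le> 4 * 2 ^ k / fact k * G k r"
          by (intro mult_right_mono abs_hat_coeff_le G0)
        then show "norm (norm (T k r)) \<le> 4 * r powr \<alpha> * inverse (exp r) / r * (inverse (fact k) * (2 * r powr \<alpha>) ^ k)"
          using r by (simp add: normT Gr power_mult_distrib field_simps abs_mult)
      qed
      ultimately show ?thesis using r by simp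
    qed
    then show "(\<lambda>k. T k r) sums (indicator {0<..} r *\<^sub>R (\<i> * wright_integrand \<alpha> (\<i> * of_real r)))"
      "summable (\<lambda>k. norm (T k r))" by auto
  qed
  have int_norm: "(\<integral>r. norm (T k r) \<partial>lborel) = \<bar>hat_coeff k\<bar> * Gamma (?s k)" for k
    unfolding normT using G[of k] by (simp add: has_bochner_integral_iff)
  have summ_int: "summable (\<lambda>k. \<integral>r. norm (T k r) \<partial>lborel)"
    unfolding int_norm
  proof (rule summable_comparison_test')
    show "summable (\<lambda>k. 4 * (Gamma (?s k) / fact k * 2 ^ k))"
      by (intro summable_mult summable_Gamma_power_series \<alpha>)
    fix k :: nat
    have "0 < Gamma (?s k)" using \<alpha> by (auto intro!: Gamma_real_pos mult_pos_pos)
    then show "norm (\<bar>hat_coeff k\<bar> * Gamma (?s k)) \<le> 4 * (Gamma (?s k) / fact k * 2 ^ k)"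
      using mult_right_mono[OF abs_hat_coeff_le[of k], of "Gamma (?s k)"] by (simp add: abs_mult field_simps del: of_nat_Suc)
  qed
  have Tint: "integrable lborel (T k)" for k using T[of k] by (simp add: has_bochner_integral_iff)
  have suminf: "(\<Sum>k. T k r) = indicator {0<..} r *\<^sub>R (\<i> * wright_integrand \<alpha> (\<i> * of_real r))" for r
    using sums[of r] by (simp add: sums_iff)
  show "set_integrable lborel {0<..} (\<lambda>r::real. \<i> * wright_integrand \<alpha> (\<i> * of_real r))"
    using integrable_suminf[OF Tint _ summ_int] summ unfolding suminf set_integrable_def by auto
  have "(\<lambda>k. integral\<^sup>L lborel (T k)) sums (LINT r:{0<..}|lborel. \<i> * wright_integrand \<alpha> (\<i> * of_real r))"
    using sums_integral[OF Tint _ summ_int] summ unfolding suminf set_lebesgue_integral_def by auto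
  moreover have "integral\<^sup>L lborel (T k) = of_real (hat_coeff k * Gamma (?s k)) * cis (real (Suc k) * (pi * \<alpha>))" for k
    using T[of k] by (simp add: has_bochner_integral_iff c_def del: of_nat_Suc)
  ultimately show "(\<lambda>k. of_real (hat_coeff k * Gamma (?s k)) * cis (real (Suc k) * (pi * \<alpha>)))
      sums (LINT r:{0<..}|lborel. \<i> * wright_integrand \<alpha> (\<i> * of_real r))" by simp
qed

text \<open>
  The sum \<open>A / \<pi>\<close> is the integral of the density times the hat function: with
  \<open>H'' = h\<close> and \<open>H 0 = 0\<close>, two integrations by parts turn that integral
  into the second difference \<open>H 2 - 2 * H 1\<close>. The hat function lies between
  \<open>0\<close> and \<open>\<theta>\<close>, and replacing \<open>h\<close> by its positive part
  only increases the integral.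
\<close>

lemma subordination_density_moment_ge:
  assumes \<alpha>: "0 < \<alpha>" "\<alpha> < 1"
    and A: "(\<lambda>k. hat_coeff k * Gamma (real (Suc k) * \<alpha>) * sin (real (Suc k) * (pi * \<alpha>))) sums A"
  shows "ennreal (A / pi) \<le> (\<integral>\<^sup>+ \<theta>\<in>{0<..2}. ennreal (\<theta> * subordination_density \<alpha> \<theta>) \<partial>lborel)"
proof -
  let ?h = "wright_series \<alpha>"
  define c where "c n = (if n < 2 then 0 else wright_coeff \<alpha> (n - 2) / (real n * real (n - 1)))" for n
  have cs: "summable (\<lambda>n. c n * x ^ n)" for x
  proof (subst summable_iff_shift[symmetric, of _ 2], rule summable_comparison_test')
    show "summable (\<lambda>n. norm (wright_coeff \<alpha> n * x ^ n) * x\<^sup>2)"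
      by (intro summable_mult2 summable_norm_wright_coeff \<alpha>)
    fix n :: nat
    let ?d = "real (n + 2) * real (Suc n)"
    have "1 * 1 \<le> ?d" by (intro mult_mono) auto
    then have "\<bar>wright_coeff \<alpha> n\<bar> / ?d \<le> \<bar>wright_coeff \<alpha> n\<bar> / 1"
      by (intro divide_left_mono) auto
    then have "\<bar>wright_coeff \<alpha> n\<bar> / ?d * (\<bar>x\<bar> ^ n * x\<^sup>2) \<le> \<bar>wright_coeff \<alpha> n\<bar> / 1 * (\<bar>x\<bar> ^ n * x\<^sup>2)"
      by (intro mult_right_mono) auto
    moreover have "norm (c (n + 2) * x ^ (n + 2)) = \<bar>wright_coeff \<alpha> n\<bar> / ?d * (\<bar>x\<bar> ^ n * x\<^sup>2)"
      by (simp add: c_def abs_mult power_abs power_add power2_eq_square del: of_nat_Suc of_nat_add)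
    ultimately show "norm (c (n + 2) * x ^ (n + 2)) \<le> norm (wright_coeff \<alpha> n * x ^ n) * x\<^sup>2"
      by (simp add: abs_mult power_abs mult.assoc)
  qed
  have ds: "summable (\<lambda>n. diffs c n * x ^ n)" for x by (rule termdiff_converges_all[OF cs])
  have dd: "diffs (diffs c) = wright_coeff \<alpha>"
    by (rule ext) (simp add: diffs_def c_def del: of_nat_Suc)
  define H where "H x = (\<Sum>n. c n * x ^ n)" for x
  define H' where "H' x = (\<Sum>n. diffs c n * x ^ n)" for x
  have H: "(H has_real_derivative H' x) (at x)" for x
    unfolding H_def [abs_def] H'_def by (rule termdiffs_strong_converges_everywhere[OF cs])
  have H': "(H' has_real_derivative ?h x) (at x)" for x
    using termdiffs_strong_converges_everywhere[OF ds, of x]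
    unfolding H'_def [abs_def] dd wright_series_def .
  have H0: "H 0 = 0" unfolding H_def by (simp add: powser_zero c_def)
  have "(\<lambda>n. c n * 2 ^ n - 2 * (c n * 1 ^ n)) sums (H 2 - 2 * H 1)"
    unfolding H_def by (intro sums_diff sums_mult summable_sums cs)
  then have "(\<lambda>n. c (n + 2) * 2 ^ (n + 2) - 2 * (c (n + 2) * 1 ^ (n + 2))) sums (H 2 - 2 * H 1)"
    by (subst sums_iff_shift) (simp add: c_def eval_nat_numeral)
  moreover have "c (n + 2) * 2 ^ (n + 2) - 2 * (c (n + 2) * 1 ^ (n + 2))
      = hat_coeff n * Gamma (real (Suc n) * \<alpha>) * sin (real (Suc n) * (pi * \<alpha>)) / pi" for n
  proof -
    have f: "fact (n + 2) = real (n + 2) * real (n + 1) * fact n" by (simp add: algebra_simps)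
    have "c (n + 2) * 2 ^ (n + 2) - 2 * (c (n + 2) * 1 ^ (n + 2)) = c (n + 2) * (2 ^ (n + 2) - 2)"
      by (simp add: algebra_simps)
    then show ?thesis unfolding hat_coeff_def f
      by (simp add: c_def wright_coeff_def ac_simps del: of_nat_Suc of_nat_add)
  qed
  moreover have "(\<lambda>n. hat_coeff n * Gamma (real (Suc n) * \<alpha>) * sin (real (Suc n) * (pi * \<alpha>)) / pi) sums (A / pi)"
    using A by (rule sums_divide)
  ultimately have A': "A / pi = H 2 - 2 * H 1" by (auto intro: sums_unique2)
  have 1: "has_bochner_integral lborel (\<lambda>\<theta>. \<theta> * ?h \<theta> * indicator {0..1} \<theta>) ((1 * H' 1 - H 1) - (0 * H' 0 - H 0))"
    by (rule has_bochner_integral_FTC_Icc_real)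
       (auto intro!: derivative_eq_intros H H' continuous_intros isCont_wright_series \<alpha>)
  have 2: "has_bochner_integral lborel (\<lambda>\<theta>. (2 - \<theta>) * ?h \<theta> * indicator {1..2} \<theta>) (((2 - 2) * H' 2 + H 2) - ((2 - 1) * H' 1 + H 1))"
    by (rule has_bochner_integral_FTC_Icc_real)
       (auto intro!: derivative_eq_intros H H' continuous_intros isCont_wright_series \<alpha>)
  let ?g = "\<lambda>\<theta>. \<theta> * ?h \<theta> * indicator {0..1} \<theta> + (2 - \<theta>) * ?h \<theta> * indicator {1..2} \<theta>"
  have "has_bochner_integral lborel (\<lambda>\<theta>. \<theta> * ?h \<theta> * indicator {0..1} \<theta> + (2 - \<theta>) * ?h \<theta> * indicator {1..2} \<theta>) (A / pi)"
    using has_bochner_integral_add[OF 1 2] by (simp add: A' H0)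
  then have "integrable lborel ?g" and A'': "A / pi = integral\<^sup>L lborel ?g"
    by (auto simp: has_bochner_integral_iff)
  then have "ennreal (A / pi) \<le> (\<integral>\<^sup>+ \<theta>. ennreal (?g \<theta>) \<partial>lborel)"
    by (simp only: ennreal_integral_le_nn_integral)
  also have "\<dots> \<le> (\<integral>\<^sup>+ \<theta>\<in>{0<..2}. ennreal (\<theta> * subordination_density \<alpha> \<theta>) \<partial>lborel)"
  proof (rule nn_integral_mono_AE)
    have *: "ennreal (\<theta> * ?h \<theta> * indicator {0..1} \<theta> + (2 - \<theta>) * ?h \<theta> * indicator {1..2} \<theta>)
        \<le> ennreal (\<theta> * subordination_density \<alpha> \<theta>) * indicator {0<..2} \<theta>" if "\<theta> \<noteq> 1" for \<theta>
    proof (cases "0 < \<theta> \<and> \<theta> \<le> 2")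
      case True
      then have h: "subordination_density \<alpha> \<theta> = ?h \<theta>"
        using subordination_density_eq_wright[OF \<alpha>, of \<theta>] by (simp add: wright_series_def)
      have "(2 - \<theta>) * ?h \<theta> \<le> \<theta> * ?h \<theta>" if "1 < \<theta>" "0 \<le> ?h \<theta>"
        using that by (intro mult_right_mono) auto
      moreover have "(2 - \<theta>) * ?h \<theta> \<le> 0" if "?h \<theta> \<le> 0"
        using that True by (intro mult_nonneg_nonpos) auto
      ultimately show ?thesis
        using True \<open>\<theta> \<noteq> 1\<close> unfolding h
        by (cases "0 \<le> ?h \<theta>") (auto split: split_indicator intro: ennreal_leI simp: ennreal_neg)
    next
      case False
      then show ?thesis using that by (cases "\<theta> = 0") (auto split: split_indicator)
    qed
    show "AE \<theta> in lborel. ennreal (\<theta> * ?h \<theta> * indicator {0..1} \<theta> + (2 - \<theta>) * ?h \<theta> * indicator {1..2} \<theta>)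
        \<le> ennreal (\<theta> * subordination_density \<alpha> \<theta>) * indicator {0<..2} \<theta>"
      using AE_lborel_singleton[of 1] by (rule eventually_mono) (rule *)
  qed
  finally show ?thesis .
qed

section \<open>The limit of order one\<close>

text \<open>
  The bounds of \<open>norm_wright_integrand_le\<close> on the real axis in the worst case
  \<open>\<alpha> = 1 / 2\<close>.
\<close>

definition wright_dominator :: "real \<Rightarrow> real" where
  "wright_dominator r = indicator {0..1} r * r powr (- 1 / 2) + indicator {1..} r * (4 * r powr (- 3 / 2))"

lemma integrable_wright_dominator: "integrable lborel wright_dominator"
proof -
  have "(\<lambda>r::real. r powr (- 1 / 2)) absolutely_integrable_on {0..1}"
    by (intro nonnegative_absolutely_integrable_1 integrable_on_powr_from_0) auto
  moreover have "(\<lambda>r::real. 4 * r powr (- 3 / 2)) absolutely_integrable_on {1..}"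
    using has_integral_integrable[OF has_integral_mult_right[OF has_integral_powr_to_inf, of "- 3 / 2" 1 4]]
    by (intro nonnegative_absolutely_integrable_1) auto
  ultimately have "integrable lebesgue wright_dominator"
    unfolding wright_dominator_def [abs_def]
    by (intro Bochner_Integration.integrable_add) (simp_all add: set_integrable_def)
  moreover have "wright_dominator \<in> borel_measurable borel"
    unfolding wright_dominator_def [abs_def] by measurable
  ultimately show ?thesis by (simp add: integrable_completion)
qed

lemma norm_wright_integrand_le_dominator:
  assumes \<alpha>: "1 / 2 \<le> \<alpha>" "\<alpha> \<le> 1" and r: "0 < r"
  shows "norm (wright_integrand \<alpha> (of_real r)) \<le> wright_dominator r"
proof (cases "r \<le> 1")
  case True
  have "norm (wright_integrand \<alpha> (of_real r)) \<le> r powr (\<alpha> - 1)"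
    using norm_wright_integrand_le(2)[of \<alpha> "of_real r"] \<alpha> r by simp
  also have "\<dots> \<le> r powr (- 1 / 2)"
    using True r \<alpha> by (intro powr_mono') auto
  finally show ?thesis using True r by (auto simp: wright_dominator_def split: split_indicator)
next
  case False
  have "norm (wright_integrand \<alpha> (of_real r)) \<le> 4 * r powr (- 1 - \<alpha>)"
    using norm_wright_integrand_le(1)[of \<alpha> "of_real r"] \<alpha> r by simp
  also have "\<dots> \<le> 4 * r powr (- 3 / 2)"
    using False \<alpha> by (intro mult_left_mono powr_mono) auto
  finally show ?thesis using False by (simp add: wright_dominator_def)
qed

lemma borel_measurable_wright_integrand:
  "(\<lambda>r::real. indicator {0<..} r *\<^sub>R wright_integrand \<alpha> (of_real r)) \<in> borel_measurable borel"
  by (intro borel_measurable_continuous_on_indicator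
        continuous_on_compose2[OF holomorphic_on_imp_continuous_on[OF holomorphic_wright_integrand]])
     (auto intro!: continuous_intros)

lemma set_integrable_wright_integrand:
  assumes \<alpha>: "1 / 2 \<le> \<alpha>" "\<alpha> \<le> 1"
  shows "set_integrable lborel {0<..} (\<lambda>r::real. wright_integrand \<alpha> (of_real r))"
  unfolding set_integrable_def
proof (rule Bochner_Integration.integrable_bound[OF integrable_wright_dominator])
  show "AE r in lborel. norm (indicator {0<..} r *\<^sub>R wright_integrand \<alpha> (of_real r)) \<le> norm (wright_dominator r)"
    using norm_wright_integrand_le_dominator[OF \<alpha>]
    by (intro AE_I2) (auto split: split_indicator intro: order_trans[OF _ abs_ge_self])
qed (use borel_measurable_wright_integrand in simp)

lemma wright_integral_tendsto:
  "((\<lambda>\<alpha>. LINT r:{0<..}|lborel. wright_integrand \<alpha> (of_real r))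
     \<longlongrightarrow> (LINT r:{0<..}|lborel. wright_integrand 1 (of_real r))) (at_left 1)"
proof (rule tendsto_at_left_sequentially[of "1 / 2"])
  fix S :: "nat \<Rightarrow> real"
  assume S: "\<And>n. S n < 1" "\<And>n. 1 / 2 < S n" "S \<longlonglongrightarrow> 1"
  show "(\<lambda>n. LINT r:{0<..}|lborel. wright_integrand (S n) (of_real r))
     \<longlonglongrightarrow> (LINT r:{0<..}|lborel. wright_integrand 1 (of_real r))"
    unfolding set_lebesgue_integral_def
  proof (rule integral_dominated_convergence[OF _ _ integrable_wright_dominator])
    show "AE r in lborel. (\<lambda>n. indicator {0<..} r *\<^sub>R wright_integrand (S n) (of_real r))
        \<longlonglongrightarrow> indicator {0<..} r *\<^sub>R wright_integrand 1 (of_real r)"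
    proof (rule AE_I2)
      fix r :: real
      have "(\<lambda>n. wright_integrand (S n) (of_real r)) \<longlonglongrightarrow> wright_integrand 1 (of_real r)" if "0 < r"
        unfolding wright_integrand_def wright_phase_def cis_conv_exp using that
        by (intro tendsto_intros S) (auto simp: powr_def)
      then show "(\<lambda>n. indicator {0<..} r *\<^sub>R wright_integrand (S n) (of_real r))
        \<longlonglongrightarrow> indicator {0<..} r *\<^sub>R wright_integrand 1 (of_real r)"
        by (auto split: split_indicator)
    qed
    show "AE r in lborel. norm (indicator {0<..} r *\<^sub>R wright_integrand (S n) (of_real r)) \<le> wright_dominator r" for n
      using norm_wright_integrand_le_dominator[of "S n"] S(1,2)[of n]
      by (intro AE_I2) (auto split: split_indicator simp: wright_dominator_def)
  qed (use borel_measurable_wright_integrand in simp_all)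
qed simp

text \<open>
  For \<open>\<alpha> = 1\<close> the phase is \<open>\<i> * r\<close>, and \<open>exp (\<i> *
  r)\<close> exactly recentres the hat function at the origin; the Fourier transform of an even hat
  function is a squared sine.
\<close>

lemma Im_wright_integrand_one:
  assumes "0 < r"
  shows "Im (wright_integrand 1 (of_real r)) = 4 * (sin (r / 2))\<^sup>2 / r\<^sup>2"
proof -
  define q where "q = 4 * (sin (r / 2))\<^sup>2 / r\<^sup>2"
  have w: "wright_phase 1 (of_real r) = \<i> * of_real r"
    using assms by (simp add: wright_phase_def)
  have "exp (\<i> * of_real r) * (1 - exp (- (\<i> * of_real r)))\<^sup>2 = exp (\<i> * of_real r) + exp (- (\<i> * of_real r)) - 2"
    by (simp add: power2_eq_square algebra_simps exp_add[symmetric] exp_minus_inverse)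
  also have "\<dots> = of_real (2 * cos r - 2)"
    by (simp add: complex_eq_iff Re_exp Im_exp)
  also have "2 * cos r - 2 = - 4 * (sin (r / 2))\<^sup>2"
    using cos_double_sin[of "r / 2"] by simp
  finally have "wright_integrand 1 (of_real r) = of_real (- 4 * (sin (r / 2))\<^sup>2) / (\<i> * of_real r * of_real r)"
    by (simp add: wright_integrand_def w)
  also have "\<dots> = \<i> * of_real q"
  proof (subst nonzero_divide_eq_eq)
    have "\<i> * of_real q * (\<i> * of_real r * of_real r) = (\<i> * \<i>) * of_real (q * r * r)"
      by (simp only: of_real_mult ac_simps)
    also have "q * r * r = 4 * (sin (r / 2))\<^sup>2"
      using assms by (simp add: q_def power2_eq_square)
    finally show "of_real (- 4 * (sin (r / 2))\<^sup>2) = \<i> * of_real q * (\<i> * of_real r * of_real r)"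
      by simp
  qed (use assms in simp)
  finally show ?thesis by (simp add: q_def)
qed

lemma Im_set_integral:
  assumes "set_integrable M A f"
  shows "Im (LINT x:A|M. f x) = (LINT x:A|M. Im (f x))"
proof -
  have "(\<integral>x. Im (indicator A x *\<^sub>R f x) \<partial>M) = Im (\<integral>x. indicator A x *\<^sub>R f x \<partial>M)"
    using assms unfolding set_integrable_def by (rule integral_Im)
  then show ?thesis by (simp add: set_lebesgue_integral_def)
qed

lemma Im_wright_integral_one_pos:
  "0 < Im (LINT r:{0<..}|lborel. wright_integrand 1 (of_real r))"
proof -
  let ?F = "\<lambda>r::real. wright_integrand 1 (of_real r)"
  have int: "set_integrable lborel {0<..} ?F" by (rule set_integrable_wright_integrand) auto
  have s: "0 < sin (1 / 2 :: real)" using pi_gt3 by (intro sin_gt_zero) auto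
  have "(sin (1 / 2 :: real))\<^sup>2 = (\<integral>r. indicator {1..2} r * (sin (1 / 2 :: real))\<^sup>2 \<partial>(lborel :: real measure))"
    by simp
  also have "\<dots> \<le> (\<integral>r. Im (indicator {0<..} r *\<^sub>R ?F r) \<partial>lborel)"
  proof (rule integral_mono)
    show "integrable lborel (\<lambda>r. indicator {1..2::real} r * (sin (1 / 2 :: real))\<^sup>2)"
      by (intro integrable_mult_left) simp
    show "integrable lborel (\<lambda>r. Im (indicator {0<..} r *\<^sub>R ?F r))"
      using int unfolding set_integrable_def by (rule integrable_Im)
    fix r :: real
    have "(sin (1 / 2 :: real))\<^sup>2 \<le> 4 * (sin (r / 2))\<^sup>2 / r\<^sup>2" if "r \<in> {1..2}"
    proof -
      have "sin (1 / 2) \<le> sin (r / 2)"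
        using that pi_gt3 by (intro sin_monotone_2pi_le) auto
      then have "(sin (1 / 2 :: real))\<^sup>2 * r\<^sup>2 \<le> (sin (r / 2))\<^sup>2 * 2\<^sup>2"
        using that s by (intro mult_mono power_mono) auto
      then show ?thesis using that by (simp add: field_simps)
    qed
    then show "indicator {1..2} r * (sin (1 / 2 :: real))\<^sup>2 \<le> Im (indicator {0<..} r *\<^sub>R ?F r)"
      using Im_wright_integrand_one[of r] by (auto split: split_indicator)
  qed
  also have "\<dots> = Im (LINT r:{0<..}|lborel. ?F r)"
    unfolding Im_set_integral[OF int] unfolding set_lebesgue_integral_def by simp
  finally show ?thesis using s by (smt (verit) zero_less_power)
qed

text \<open>
  After the rotation the tested density converges, by dominated convergence, to a positive limit.
\<close>

lemma subordination_density_moment_uniform: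
  "\<exists>c>0. \<exists>b\<in>{1/2..<1}. \<forall>\<alpha>\<in>{b<..<1}. ennreal c \<le>
     (\<integral>\<^sup>+ \<theta>\<in>{0<..2}. ennreal (\<theta> * subordination_density \<alpha> \<theta>) \<partial>lborel)"
proof -
  define L where "L = Im (LINT r:{0<..}|lborel. wright_integrand 1 (of_real r))"
  have L: "0 < L" unfolding L_def by (rule Im_wright_integral_one_pos)
  have "((\<lambda>\<alpha>. Im (LINT r:{0<..}|lborel. wright_integrand \<alpha> (of_real r))) \<longlongrightarrow> L) (at_left 1)"
    unfolding L_def by (intro tendsto_intros wright_integral_tendsto)
  then have "\<forall>\<^sub>F \<alpha> in at_left 1. L / 2 < Im (LINT r:{0<..}|lborel. wright_integrand \<alpha> (of_real r))"
    by (rule order_tendstoD) (use L in simp)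
  then obtain b' where b': "b' < 1"
    "\<And>\<alpha>. b' < \<alpha> \<Longrightarrow> \<alpha> < 1 \<Longrightarrow> L / 2 < Im (LINT r:{0<..}|lborel. wright_integrand \<alpha> (of_real r))"
    unfolding eventually_at_left_field by blast
  define b where "b = max b' (1 / 2)"
  show ?thesis
  proof (intro exI[of _ "L / 2 / pi"] conjI bexI[of _ b] ballI)
    fix \<alpha> assume "\<alpha> \<in> {b<..<1}"
    then have \<alpha>: "0 < \<alpha>" "\<alpha> < 1" "1 / 2 \<le> \<alpha>" "\<alpha> \<le> 1" "b' < \<alpha>" by (auto simp: b_def)
    let ?I = "LINT r:{0<..}|lborel. \<i> * wright_integrand \<alpha> (\<i> * of_real r)"
    note imag = wright_integrand_imag_axis_integral[OF \<alpha>(1,2)]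
    have "?I = (LINT r:{0<..}|lborel. wright_integrand \<alpha> (of_real r))"
      by (rule wright_contour_rotation[OF \<alpha>(1,2) set_integrable_wright_integrand[OF \<alpha>(3,4)] imag(1)])
    then have "L / 2 \<le> Im ?I" using b'(2)[OF \<alpha>(5,2)] by simp
    have "(\<lambda>k. hat_coeff k * Gamma (real (Suc k) * \<alpha>) * sin (real (Suc k) * (pi * \<alpha>))) sums Im ?I"
      using sums_Im[OF imag(2)] by (simp del: of_nat_Suc)
    then have "ennreal (Im ?I / pi) \<le> (\<integral>\<^sup>+ \<theta>\<in>{0<..2}. ennreal (\<theta> * subordination_density \<alpha> \<theta>) \<partial>lborel)"
      by (rule subordination_density_moment_ge[OF \<alpha>(1,2)])
    moreover have "ennreal (L / 2 / pi) \<le> ennreal (Im ?I / pi)"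
      using \<open>L / 2 \<le> Im ?I\<close> by (intro ennreal_leI divide_right_mono) auto
    ultimately show "ennreal (L / 2 / pi) \<le> (\<integral>\<^sup>+ \<theta>\<in>{0<..2}. ennreal (\<theta> * subordination_density \<alpha> \<theta>) \<partial>lborel)"
      by (rule order_trans[rotated])
  qed (use L b' in \<open>auto simp: b_def\<close>)
qed

section \<open>The estimate\<close>

text \<open>
  Near \<open>\<alpha> = 1\<close> the function \<open>\<gamma>\<close> is constant, with the uniform lower bound for the density; at the
  remaining orders, the bound that belongs to the order is used.
\<close>

theorem theorem1:
  "\<exists>\<gamma> :: real \<Rightarrow> real.
     (\<forall>\<alpha>\<in>{0<..<1}. 0 < \<gamma> \<alpha>) \<and>
     Limsup (at_left 1) (\<lambda>\<alpha>. ereal (\<gamma> \<alpha>)) < \<infinity> \<and>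
     (\<forall>\<alpha>\<in>{0<..<1}. \<forall>T > 0. \<forall>u0 :: real ^ 'n \<Rightarrow> real.
        u0 \<in> borel_measurable lebesgue \<longrightarrow>
        (\<forall>x. 0 \<le> u0 x) \<longrightarrow>
        (\<exists>u. mild_solution \<alpha> (1 + 2 / real CARD('n)) u0 (ereal T) u) \<longrightarrow>
        (\<forall>z. \<forall>\<rho> > 0. \<rho> powr (2 / \<alpha>) < T \<longrightarrow>
           (\<integral>\<^sup>+ y\<in>cball z \<rho>. ennreal (u0 y) \<partial>lebesgue)
             \<le> ennreal (\<gamma> \<alpha>
                 * (T / \<rho> powr (2 / \<alpha>)) powr ((1 - \<alpha>) * real CARD('n) / 2)
                 * ln (T / \<rho> powr (2 / \<alpha>)) powr (- real CARD('n) / 2))))"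
proof -
  let ?k = "heat_ball_const TYPE('n)" and ?q = "2 / real CARD('n)"
  let ?mom = "\<lambda>\<alpha>. \<integral>\<^sup>+ \<theta>\<in>{0<..2}. ennreal (\<theta> * subordination_density \<alpha> \<theta>) \<partial>lborel"
  define K where "K \<alpha>0 c = 2 / (?k * c) * ((1 - 2 powr (- ?q)) *
    (\<alpha>0 * ?k * c * unit_ball_vol (real CARD('n)) powr (- ?q))) powr (- real CARD('n) / 2)" for \<alpha>0 c
  have K_pos: "0 < K \<alpha>0 c" if "0 < \<alpha>0" "0 < c" for \<alpha>0 c
  proof -
    have "0 < 1 - 2 powr (- ?q)" by (simp add: powr_less_one)
    moreover have "0 < unit_ball_vol (real CARD('n))" by simp
    then have "0 < unit_ball_vol (real CARD('n)) powr (- ?q)" unfolding powr_gt_zero by linarith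
    ultimately have "0 < (1 - 2 powr (- ?q)) * (\<alpha>0 * ?k * c * unit_ball_vol (real CARD('n)) powr (- ?q))"
      using that heat_ball_const_pos[where 'n = 'n] by (intro mult_pos_pos)
    then have E: "0 < ((1 - 2 powr (- ?q)) * (\<alpha>0 * ?k * c * unit_ball_vol (real CARD('n)) powr (- ?q))) powr (- real CARD('n) / 2)"
      unfolding powr_gt_zero by linarith
    have "0 < 2 / (?k * c)" using that heat_ball_const_pos[where 'n = 'n] by simp
    then show ?thesis unfolding K_def using E by (rule mult_pos_pos)
  qed
  obtain c b where c: "0 < c" and b: "1 / 2 \<le> b" "b < 1"
    and near: "\<And>\<alpha>. b < \<alpha> \<Longrightarrow> \<alpha> < 1 \<Longrightarrow> ennreal c \<le> ?mom \<alpha>"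
    using subordination_density_moment_uniform by fastforce
  have "\<forall>\<alpha>\<in>{0<..<1}. \<exists>e>0. ennreal e \<le> ?mom \<alpha>"
    using subordination_density_moment_pos by simp
  then obtain e where "\<forall>\<alpha>\<in>{0<..<1}. 0 < e \<alpha> \<and> ennreal (e \<alpha>) \<le> ?mom \<alpha>"
    by (auto dest!: bchoice)
  then have e: "0 < e \<alpha> \<and> ennreal (e \<alpha>) \<le> ?mom \<alpha>" if "0 < \<alpha>" "\<alpha> < 1" for \<alpha>
    using that by simp
  define \<gamma> where "\<gamma> \<alpha> = (if b < \<alpha> then K (1 / 2) c else K \<alpha> (e \<alpha>))" for \<alpha>
  show ?thesis
  proof (intro exI[of _ \<gamma>] conjI ballI allI impI)
    fix \<alpha> :: real assume "\<alpha> \<in> {0<..<1}"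
    then show "0 < \<gamma> \<alpha>" using K_pos c e[of \<alpha>] by (auto simp: \<gamma>_def)
  next
    have "\<forall>\<^sub>F \<alpha> in at_left 1. ereal (\<gamma> \<alpha>) \<le> ereal (K (1 / 2) c)"
      using eventually_at_left_real[OF b(2)] by (rule eventually_mono) (simp add: \<gamma>_def)
    then have "Limsup (at_left 1) (\<lambda>\<alpha>. ereal (\<gamma> \<alpha>)) \<le> ereal (K (1 / 2) c)"
      by (rule Limsup_bounded)
    then show "Limsup (at_left 1) (\<lambda>\<alpha>. ereal (\<gamma> \<alpha>)) < \<infinity>"
      by (rule le_less_trans) simp
  next
    fix \<alpha> T \<rho> :: real and u0 :: "real ^ 'n \<Rightarrow> real" and z :: "real ^ 'n"
    assume \<alpha>: "\<alpha> \<in> {0<..<1}" and u0: "u0 \<in> borel_measurable lebesgue" "\<forall>x. 0 \<le> u0 x"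
      and "\<exists>u. mild_solution \<alpha> (1 + 2 / real CARD('n)) u0 (ereal T) u"
      and \<rho>: "0 < \<rho>" "\<rho> powr (2 / \<alpha>) < T"
    then obtain u where u: "mild_solution \<alpha> (1 + 2 / real CARD('n)) u0 (ereal T) u" by blast
    have *: "(\<integral>\<^sup>+ y\<in>cball z \<rho>. ennreal (u0 y) \<partial>lebesgue) \<le> ennreal (K \<alpha>0 c'
        * (T / \<rho> powr (2 / \<alpha>)) powr ((1 - \<alpha>) * real CARD('n) / 2)
        * ln (T / \<rho> powr (2 / \<alpha>)) powr (- real CARD('n) / 2))"
      if "0 < \<alpha>0" "\<alpha>0 \<le> \<alpha>" "0 < c'" "ennreal c' \<le> ?mom \<alpha>" for \<alpha>0 c'
      unfolding K_def using \<alpha> u0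
      by (intro mild_solution_mass_le[OF that(1,2) _ that(3,4) u _ _ \<rho>]) auto
    show "(\<integral>\<^sup>+ y\<in>cball z \<rho>. ennreal (u0 y) \<partial>lebesgue) \<le> ennreal (\<gamma> \<alpha>
        * (T / \<rho> powr (2 / \<alpha>)) powr ((1 - \<alpha>) * real CARD('n) / 2)
        * ln (T / \<rho> powr (2 / \<alpha>)) powr (- real CARD('n) / 2))"
      using *[of "1 / 2" c] *[of \<alpha> "e \<alpha>"] \<alpha> b c near[of \<alpha>] e[of \<alpha>]
      by (cases "b < \<alpha>") (simp_all add: \<gamma>_def)
  qed
qed

end
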